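(* Let $G$ be a finite simple graph with maximum degree at most $4$ such that no connected component of $G$ is isomorphic to $C_{2,5}$. Then $\nu_s(G)\geq \frac{1}{9}\bigl(n(G)-i(G)\bigr)$, where $n(G)$ is the number of vertices of $G$ and $i(G)$ is the number of isolated vertices of $G$.
   Context: An induced matching of a graph $G=(V,E)$ is a set $M\subseteq E$ of edges such that every vertex of $G$ is incident to at most one edge of $M$ and, whenever $ab,cd\in M$ are distinct, none of $ac,ad,bc,bd$ belongs to $E$. The strong matching number $\nu_s(G)$ is the maximum size of an induced matching of $G$. The graph $C_{2,5}$ is obtained from the $5$-cycle $C_5$ by replacing each vertex by two non-adjacent vertices: its vertex set is $\{(i,j): i\in \mathbb{Z}_5,\ j\in\{1,2\}\}$, and $(i,j)$ is adjacent to $(i',j')$ if and only if $i'-i\equiv \pm 1 \pmod 5$. *)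

theory Defs
  imports Complex_Main "HOL-Number_Theory.Cong"
begin

type_synonym 'a ugraph = "'a set \<times> 'a set set"

abbreviation verts :: "'a ugraph \<Rightarrow> 'a set" where
  "verts G \<equiv> fst G"

abbreviation edges :: "'a ugraph \<Rightarrow> 'a set set" where
  "edges G \<equiv> snd G"

definition finite_simple_graph :: "'a ugraph \<Rightarrow> bool" where
  "finite_simple_graph G \<longleftrightarrow>
     finite (verts G) \<and> (\<forall>e\<in>edges G. e \<subseteq> verts G \<and> card e = 2)"

definition adj :: "'a ugraph \<Rightarrow> 'a \<Rightarrow> 'a \<Rightarrow> bool" where
  "adj G u v \<longleftrightarrow> {u, v} \<in> edges G"

definition degree :: "'a ugraph \<Rightarrow> 'a \<Rightarrow> nat" where
  "degree G v = card {e \<in> edges G. v \<in> e}"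

text \<open>The inserted 0 only matters for the graph without vertices.\<close>

definition max_degree :: "'a ugraph \<Rightarrow> nat" where
  "max_degree G = Max (insert 0 (degree G ` verts G))"

definition isolated_verts :: "'a ugraph \<Rightarrow> 'a set" where
  "isolated_verts G = {v \<in> verts G. degree G v = 0}"

definition induced_subgraph :: "'a ugraph \<Rightarrow> 'a set \<Rightarrow> 'a ugraph" where
  "induced_subgraph G W = (W, {e \<in> edges G. e \<subseteq> W})"

definition components :: "'a ugraph \<Rightarrow> 'a ugraph set" where
  "components G =
     {induced_subgraph G {v \<in> verts G. (adj G)\<^sup>*\<^sup>* u v} | u. u \<in> verts G}"

definition isomorphic :: "'a ugraph \<Rightarrow> 'b ugraph \<Rightarrow> bool" where
  "isomorphic G H \<longleftrightarrow> (\<exists>f. bij_betw f (verts G) (verts H) \<and>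
     (\<forall>u\<in>verts G. \<forall>v\<in>verts G. adj G u v \<longleftrightarrow> adj H (f u) (f v)))"

definition induced_matching :: "'a ugraph \<Rightarrow> 'a set set \<Rightarrow> bool" where
  "induced_matching G M \<longleftrightarrow>
     M \<subseteq> edges G \<and>
     (\<forall>v\<in>verts G. card {e \<in> M. v \<in> e} \<le> 1) \<and>
     (\<forall>a b c d. {a, b} \<in> M \<longrightarrow> {c, d} \<in> M \<longrightarrow> {a, b} \<noteq> {c, d} \<longrightarrow>
        {a, c} \<notin> edges G \<and> {a, d} \<notin> edges G \<and>
        {b, c} \<notin> edges G \<and> {b, d} \<notin> edges G)"

definition strong_matching_number :: "'a ugraph \<Rightarrow> nat" where
  "strong_matching_number G = Max {card M | M. induced_matching G M}"

text \<open>Residues modulo 5 are represented by the integers 0, ..., 4.\<close>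

definition C25 :: "(int \<times> nat) ugraph" where
  "C25 = ({0..<5} \<times> {1, 2},
     {{(i, j), (i', j')} | i j i' j'.
        i \<in> {0..<5} \<and> i' \<in> {0..<5} \<and> j \<in> {1, 2} \<and> j' \<in> {1, 2} \<and>
        ([i' - i = 1] (mod 5) \<or> [i' - i = -1] (mod 5))})"

end

theory Submission
  imports Defs
begin

text \<open>
  Call the cost of an edge \<open>uv\<close> the number of vertices in \<open>B = N(u) \<union> N(v)\<close> plus the number of
  vertices outside \<open>B\<close> that become isolated when \<open>B\<close> is removed.  If some edge has cost at most 9,
  it can be added to an induced matching of \<open>G - B\<close>, and the bound follows by induction; \<open>C25\<close> is
  4-regular, so it never appears as a new component.

  So suppose that every edge has cost at least 10.  Edges at a vertex of degree 1 or 2 have a small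
  set \<open>B\<close>, hence isolate many vertices, and this dense spot contains a cheap edge.  Thus all degrees
  are 3 or 4.  For a vertex \<open>w\<close> let \<open>hit w\<close> be the set of edges whose removal isolates \<open>w\<close>.  For every
  neighbour \<open>n\<close> of \<open>w\<close> the at most three other neighbours of \<open>n\<close> cover all edges in \<open>hit w\<close>; this
  leads to \<open>card (hit w) \<le> 5\<close> for degree 3 and \<open>card (hit w) \<le> 4\<close> for degree 4.  Double counting
  the pairs of an edge and a vertex it isolates then gives equality everywhere: the graph is
  4-regular and triangle-free and \<open>card (hit w) = 4\<close> for all \<open>w\<close>.  The edges in \<open>hit w\<close> form two
  paths with two edges, which is impossible, or contain a path with three edges, and then \<open>w\<close> lies
  in a copy of \<open>C25\<close>.
\<close>

section \<open>Graphs of maximum degree at most 4, given by neighbourhoods\<close>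

locale deg4_graph =
  fixes V :: "'a set" and N :: "'a \<Rightarrow> 'a set"
  assumes finite_V: "finite V"
    and N_subset: "N x \<subseteq> V"
    and N_sym: "y \<in> N x \<Longrightarrow> x \<in> N y"
    and N_irrefl: "x \<notin> N x"
    and N_card: "card (N x) \<le> 4"
begin

text \<open>The condition \<open>N w \<noteq> {}\<close> leaves out vertices that were isolated
  already before \<open>B\<close> is removed; only newly isolated ones count towards the cost of an
  edge.\<close>

definition isol :: "'a set \<Rightarrow> 'a set" where
  "isol B = {w. N w \<noteq> {} \<and> w \<notin> B \<and> N w \<subseteq> B}"

lemma finite_N [simp]: "finite (N x)"
  using N_subset finite_V by (rule finite_subset)

lemma N_commute: "y \<in> N x \<longleftrightarrow> x \<in> N y"
  using N_sym by blast

lemma finite_isol [simp]: "finite (isol B)"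
proof (rule finite_subset)
  show "isol B \<subseteq> V"
    unfolding isol_def using N_subset N_sym by blast
qed (rule finite_V)

lemma sum_card_inter_swap:
  assumes "finite A" "finite B"
  shows "(\<Sum>a\<in>A. card (N a \<inter> B)) = (\<Sum>b\<in>B. card (N b \<inter> A))"
proof -
  have c: "card (N a \<inter> S) = (\<Sum>b\<in>S. if b \<in> N a then 1 else 0)" if "finite S" for a S
    using that by (simp add: sum.If_cases Int_commute)
  have "(\<Sum>a\<in>A. card (N a \<inter> B)) = (\<Sum>a\<in>A. \<Sum>b\<in>B. if b \<in> N a then 1 else 0)"
    by (simp add: c assms)
  also have "\<dots> = (\<Sum>b\<in>B. \<Sum>a\<in>A. if b \<in> N a then 1 else 0)"
    by (rule sum.swap)
  also have "\<dots> = (\<Sum>b\<in>B. \<Sum>a\<in>A. if a \<in> N b then 1 else 0)"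
    by (simp add: N_commute)
  also have "\<dots> = (\<Sum>b\<in>B. card (N b \<inter> A))"
    by (simp add: c assms)
  finally show ?thesis .
qed

text \<open>Edges leaving \<open>A\<close> are counted from their ends in \<open>W\<close>, where
  the degree bound limits each contribution.\<close>

lemma sum_degree_eq:
  assumes "finite A" "finite W" "\<And>p. p \<in> A \<Longrightarrow> N p \<subseteq> W"
  shows "(\<Sum>p\<in>A. card (N p)) = (\<Sum>y\<in>W. card (N y \<inter> A))"
proof -
  have "(\<Sum>p\<in>A. card (N p)) = (\<Sum>p\<in>A. card (N p \<inter> W))"
    using assms(3) by (intro sum.cong refl) (simp add: Int_absorb2)
  then show ?thesis using sum_card_inter_swap[OF assms(1,2)] by simp
qed

text \<open>\<open>S\<close> stands for neighbours of \<open>y\<close> known to lie outside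
  \<open>A\<close>; each of them uses up one of the four places at \<open>y\<close>.\<close>

lemma card_inter_le:
  assumes "finite S" "S \<subseteq> N y" "S \<inter> A = {}"
  shows "card (N y \<inter> A) + card S \<le> 4"
proof -
  have "card (N y \<inter> A) + card S = card ((N y \<inter> A) \<union> S)"
    using assms by (subst card_Un_disjoint) auto
  also have "\<dots> \<le> card (N y)"
    using assms by (intro card_mono) auto
  finally show ?thesis using N_card[of y] by simp
qed

lemma N_eqI:
  assumes "S \<subseteq> N x" "4 \<le> card S"
  shows "N x = S"
  using card_seteq[of "N x" S] assms N_card[of x] by simp

end

section \<open>Graphs in which every edge is costly\<close>

locale costly_graph = deg4_graph +
  assumes cost: "v \<in> N u \<Longrightarrow> 10 \<le> card (N u \<union> N v) + card (isol (N u \<union> N v))"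
begin

lemma isol_large:
  assumes "v \<in> N u" "card (N u \<union> N v) \<le> k"
  shows "10 \<le> k + card (isol (N u \<union> N v))"
  using cost[OF assms(1)] assms(2) by linarith

lemma isolD:
  assumes "w \<in> isol (N u \<union> N v)"
  shows "w \<notin> N u" "w \<notin> N v" "u \<notin> N w" "v \<notin> N w" "N w \<subseteq> N u \<union> N v" "N w \<noteq> {}"
  using assms N_sym unfolding isol_def by auto

section \<open>Vertices of degree 1\<close>

definition leaves :: "'a \<Rightarrow> 'a set" where
  "leaves x = {p \<in> N x. N p = {x}}"

text \<open>The edge \<open>wx\<close> at a leaf removes only \<open>x\<close> and
  \<open>N x\<close>, so it must isolate many vertices. An isolated vertex is not adjacent to
  \<open>x\<close>, being outside \<open>N x\<close>, nor to a leaf of \<open>x\<close>, whose only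
  neighbour is \<open>x\<close>.\<close>

lemma leaf_reach:
  assumes leaf: "w \<in> leaves x"
  defines "I \<equiv> isol (N w \<union> N x)"
  shows "9 \<le> card (N x) + card I" "p \<in> I \<Longrightarrow> N p \<subseteq> N x - leaves x" "x \<notin> I"
proof -
  have w: "w \<in> N x" "N w = {x}" using leaf by (auto simp: leaves_def)
  have B: "N w \<union> N x = insert x (N x)" using w by auto
  have "card (N w \<union> N x) = card (N x) + 1" unfolding B using N_irrefl by simp
  then show "9 \<le> card (N x) + card I" using cost[of x w] w by (auto simp: I_def)
  show "N p \<subseteq> N x - leaves x" if "p \<in> I"
  proof
    fix q assume q: "q \<in> N p"
    have p: "p \<noteq> x" "p \<notin> N x" "N p \<subseteq> insert x (N x)"
      using that unfolding I_def isol_def B by auto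
    have "q \<noteq> x" using q p N_sym by blast
    moreover have "q \<notin> leaves x" using p N_sym[OF q] by (auto simp: leaves_def)
    ultimately show "q \<in> N x - leaves x" using q p by auto
  qed
  show "x \<notin> I" unfolding I_def isol_def B by auto
qed

text \<open>Otherwise the edge \<open>py\<close> would be cheap: it removes at most 5 vertices, and
  all that it isolates lies in \<open>N x - {y}\<close>, which has at most 3 elements.\<close>

lemma leaf_neighbour_escapes:
  assumes leaf: "w \<in> leaves x" and y: "y \<in> N x" and p: "p \<in> leaves y"
  shows "\<not> N y \<subseteq> insert x (isol (N w \<union> N x))"
proof
  assume sub: "N y \<subseteq> insert x (isol (N w \<union> N x))"
  have p': "p \<in> N y" "N p = {y}" using p by (auto simp: leaves_def)
  have B: "N p \<union> N y = insert y (N y)" using p' by auto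
  have "isol (N p \<union> N y) \<subseteq> N x - {y}"
  proof
    fix r assume r: "r \<in> isol (N p \<union> N y)"
    then obtain q where q: "q \<in> N r" using isolD(6) by blast
    have ry: "r \<noteq> y" "r \<notin> N y" "N r \<subseteq> insert y (N y)" using r unfolding isol_def B by auto
    have "q \<noteq> y" using q ry N_sym by blast
    then have "q \<in> N y" using q ry by auto
    then have "q = x \<or> q \<in> isol (N w \<union> N x)" using sub by auto
    then have "r \<in> N x"
      using N_sym[OF q] leaf_reach(2)[OF leaf, of q] by blast
    then show "r \<in> N x - {y}" using ry by simp
  qed
  then have "card (isol (N p \<union> N y)) \<le> card (N x - {y})" by (intro card_mono) auto
  also have "\<dots> \<le> 3" using y N_card[of x] by simp
  finally have "card (isol (N p \<union> N y)) \<le> 3" .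
  moreover have "card (N p \<union> N y) \<le> 5" unfolding B using N_irrefl N_card[of y] by simp
  ultimately show False using cost[of y p] N_sym[OF p'(1)] by linarith
qed

text \<open>
  Every vertex of \<open>isol (N w \<union> N x)\<close> is counted twice on the edges to \<open>N x - leaves x\<close> if edges to
  leaves have weight 2.
\<close>

lemma leaf_count:
  assumes leaf: "w \<in> leaves x" and l: "\<And>y. min 2 (card (leaves y)) \<le> l" and l1: "1 \<le> l"
  shows "18 \<le> 2 * card (N x) + (2 + l) * (card (N x) - card (leaves x))"
proof -
  let ?I = "isol (N w \<union> N x)" and ?X = "N x - leaves x"
  have fl: "finite (leaves y)" for y unfolding leaves_def by simp
  have IX: "N p \<subseteq> ?X" if "p \<in> ?I" for p using leaf_reach(2)[OF leaf that] .
  have le: "card (N y \<inter> ?I) + card (leaves y \<inter> ?I) \<le> 2 + l" if y: "y \<in> ?X" for y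
  proof (cases "leaves y = {}")
    case True
    have "card (N y \<inter> ?I) + card {x} \<le> 4"
      using y N_sym leaf_reach(3)[OF leaf] by (intro card_inter_le) auto
    then show ?thesis using True l1 by simp
  next
    case False
    then obtain p where "p \<in> leaves y" by blast
    \<comment> \<open>A second place at \<open>y\<close>, besides that of \<open>x\<close>, which
      does not lead into \<open>?I\<close>; it makes up for the double weight of the leaves of
      \<open>y\<close>.\<close>
    then obtain s where s: "s \<in> N y" "s \<noteq> x" "s \<notin> ?I"
      using leaf_neighbour_escapes[OF leaf] y by blast
    have "card (N y \<inter> ?I) + card {x, s} \<le> 4"
      using y s N_sym leaf_reach(3)[OF leaf] by (intro card_inter_le) auto
    moreover have "card (leaves y \<inter> ?I) \<le> card (leaves y)" by (intro card_mono fl) auto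
    moreover have "card (leaves y \<inter> ?I) \<le> card (N y \<inter> ?I)"
      by (intro card_mono) (auto simp: leaves_def)
    ultimately show ?thesis using l[of y] s by simp
  qed
  have two: "2 \<le> card (N p) + card ({y \<in> ?X. p \<in> leaves y})" if "p \<in> ?I" for p
  proof (cases "card (N p) \<ge> 2")
    case False
    moreover have "card (N p) \<noteq> 0" using isolD(6)[OF that] by simp
    ultimately have "card (N p) = 1" by linarith
    then obtain y where y: "N p = {y}" by (auto simp: card_1_singleton_iff)
    then have "{y \<in> ?X. p \<in> leaves y} = {y}" using IX[OF that] N_sym by (auto simp: leaves_def)
    then show ?thesis using y by simp
  qed simp
  have "2 * card ?I = (\<Sum>p\<in>?I. 2)" by simp
  also have "\<dots> \<le> (\<Sum>p\<in>?I. card (N p) + card ({y \<in> ?X. p \<in> leaves y}))"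
    by (intro sum_mono two)
  also have "\<dots> = (\<Sum>p\<in>?I. card (N p)) + (\<Sum>p\<in>?I. card ({y \<in> ?X. p \<in> leaves y}))"
    by (rule sum.distrib)
  also have "(\<Sum>p\<in>?I. card (N p)) = (\<Sum>y\<in>?X. card (N y \<inter> ?I))"
    by (intro sum_degree_eq IX) auto
  also have "(\<Sum>p\<in>?I. card ({y \<in> ?X. p \<in> leaves y})) = (\<Sum>y\<in>?X. card {p\<in>?I. p \<in> leaves y})"
    by (rule sum_multicount_gen[symmetric]) auto
  also have "(\<Sum>y\<in>?X. card (N y \<inter> ?I)) + (\<Sum>y\<in>?X. card {p\<in>?I. p \<in> leaves y})
     = (\<Sum>y\<in>?X. card (N y \<inter> ?I) + card (leaves y \<inter> ?I))"
    by (simp add: sum.distrib Int_def conj_commute)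
  also have "\<dots> \<le> (\<Sum>y\<in>?X. 2 + l)" by (intro sum_mono le)
  also have "\<dots> = (2 + l) * (card (N x) - card (leaves x))"
    using fl by (simp add: card_Diff_subset leaves_def)
  finally show ?thesis using leaf_reach(1)[OF leaf] by linarith
qed

text \<open>\<open>leaf_count\<close> is bootstrapped. With the trivial \<open>l = 2\<close> it
  shows that a vertex has at most one leaf. This permits \<open>l = 1\<close>, and at a vertex with
  a leaf the right-hand side is then at most 8 + 3 * 3 = 17.\<close>

lemma no_leaf: "card (N w) \<noteq> 1"
proof
  assume "card (N w) = 1"
  then obtain x where "N w = {x}" by (auto simp: card_1_singleton_iff)
  then have w: "w \<in> leaves x" using N_sym by (auto simp: leaves_def)
  have fl: "finite (leaves y)" for y unfolding leaves_def by simp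
  have "card (leaves y) \<le> 1" for y
  proof (cases "leaves y = {}")
    case False
    then obtain p where p: "p \<in> leaves y" by blast
    have "18 \<le> 2 * card (N y) + 4 * (card (N y) - card (leaves y))"
      using leaf_count[OF p, of 2] by simp
    then show ?thesis using N_card[of y] by arith
  qed simp
  then have "min 2 (card (leaves y)) \<le> 1" for y
    by (simp add: min.coboundedI2)
  from leaf_count[OF w this]
  have "18 \<le> 2 * card (N x) + 3 * (card (N x) - card (leaves x))" by simp
  moreover have "1 \<le> card (leaves x)" using w fl[of x] by (simp add: Suc_le_eq card_gt_0_iff) blast
  ultimately show False using N_card[of x] by linarith
qed

section \<open>Vertices of degree 2\<close>

lemma min2: "N v \<noteq> {} \<Longrightarrow> 2 \<le> card (N v)"
  using no_leaf[of v] finite_N[of v] card_0_eq[of "N v"] by linarith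

text \<open>Double counting between the isolated vertices, now of degree at least 2, and their
  possible neighbours. Each of the latter spends a place on \<open>x\<close> or \<open>w\<close>, so
  it has at most 3 neighbours among the isolated vertices. Comparison with the cost bound excludes a
  triangle and forces the maximal degree at \<open>x\<close>.\<close>

lemma degree2_reach:
  assumes w: "N w = {x, z}" "x \<noteq> z"
  shows "z \<notin> N x" "card (N x) = 4" "4 \<le> card (isol (N w \<union> N x))"
    "p \<in> isol (N w \<union> N x) \<Longrightarrow> N p \<subseteq> insert z (N x - {w})"
proof -
  let ?I = "isol (N w \<union> N x)"
  have wx: "w \<in> N x" "x \<in> N w" "w \<in> N z" using w N_sym[of x w] N_sym[of z w] by auto
  have ne: "w \<noteq> x" "w \<noteq> z" using wx N_irrefl by auto
  have xI: "x \<notin> ?I" "w \<notin> ?I" "z \<notin> ?I" using wx w unfolding isol_def by auto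
  have IW: "N p \<subseteq> insert z (N x - {w})" if "p \<in> ?I" for p
  proof
    fix q assume q: "q \<in> N p"
    have "q \<in> {x, z} \<union> N x" "q \<noteq> x" using isolD[OF that] q w by auto
    moreover have "q \<noteq> w" using N_sym[OF q] that xI w by auto
    ultimately show "q \<in> insert z (N x - {w})" by auto
  qed
  then show "p \<in> ?I \<Longrightarrow> N p \<subseteq> insert z (N x - {w})" .
  have "2 * card ?I = (\<Sum>p\<in>?I. 2)" by simp
  also have "\<dots> \<le> (\<Sum>p\<in>?I. card (N p))" by (intro sum_mono min2) (auto simp: isol_def)
  also have "\<dots> = (\<Sum>y\<in>insert z (N x - {w}). card (N y \<inter> ?I))"
    by (intro sum_degree_eq IW) auto
  finally have sum: "2 * card ?I \<le> (\<Sum>y\<in>insert z (N x - {w}). card (N y \<inter> ?I))" .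
  have y3: "card (N y \<inter> ?I) \<le> 3" if "y \<in> N x" for y
    using card_inter_le[of "{x}" y ?I] N_sym[OF that] xI by auto
  have z3: "card (N z \<inter> ?I) \<le> 3"
    using card_inter_le[of "{w}" z ?I] wx xI by auto
  show zx: "z \<notin> N x"
  proof
    assume z: "z \<in> N x"
    \<comment> \<open>In a triangle both \<open>w\<close> and \<open>x\<close> occupy places at
      \<open>z\<close>. With d the degree of \<open>x\<close> this gives 2 * (9 - d) <= 2 + 3 * (d -
      2), which fails for d up to 4.\<close>
    have "card (N z \<inter> ?I) \<le> 2"
      using card_inter_le[of "{w, x}" z ?I] wx xI ne N_sym[OF z] by auto
    moreover have W: "insert z (N x - {w}) = insert z (N x - {w, z})" using z by auto
    moreover have "(\<Sum>y\<in>N x - {w, z}. card (N y \<inter> ?I)) \<le> (\<Sum>y\<in>N x - {w, z}. 3)"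
      by (intro sum_mono y3) auto
    moreover have "card (N x - {w, z}) = card (N x) - 2"
      using wx z ne by (simp add: card_Diff_subset)
    ultimately have "2 * card ?I \<le> 2 + 3 * (card (N x) - 2)"
      using sum by simp
    moreover have "N w \<union> N x = insert x (N x)" using w z by auto
    then have "card (N w \<union> N x) = card (N x) + 1" using N_irrefl by simp
    then have "10 \<le> card (N x) + 1 + card ?I" using cost[of x w] wx by auto
    ultimately show False using N_card[of x] by arith
  qed
  have zW: "z \<notin> N x - {w}" using zx by simp
  have "(\<Sum>y\<in>N x - {w}. card (N y \<inter> ?I)) \<le> (\<Sum>y\<in>N x - {w}. 3)"
    by (intro sum_mono y3) auto
  \<comment> \<open>With d the degree of \<open>x\<close>, the bound 2 * (8 - d) <= 3 * d leaves
    only d = 4.\<close>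
  then have "2 * card ?I \<le> 3 + 3 * (card (N x) - 1)"
    using sum zW z3 wx by simp
  moreover have "N w \<union> N x = insert x (insert z (N x))" using w by auto
  then have "card (N w \<union> N x) = card (N x) + 2" using N_irrefl zx w by simp
  then have "10 \<le> card (N x) + 2 + card ?I" using cost[of x w] wx by auto
  ultimately show "card (N x) = 4" "4 \<le> card ?I" using N_card[of x] by arith+
qed

text \<open>A vertex of \<open>P\<close> is not adjacent to one of \<open>R\<close>, whose
  neighbours lie in \<open>N x\<close> or equal \<open>z\<close>. \<open>P\<close> is non-empty,
  since \<open>wz\<close> isolates at least 4 vertices and at most 3 of them lie in
  \<open>N x\<close>. A vertex of \<open>P\<close> needs two neighbours among the three elements of
  \<open>N z - {w}\<close>, which leaves room for only one element of \<open>R\<close>.\<close>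

lemma degree2_overlap:
  assumes w: "N w = {x, z}" "x \<noteq> z"
  defines "R \<equiv> isol (N w \<union> N x) \<inter> N z" and "P \<equiv> isol (N w \<union> N z) - N x"
  shows "R \<subseteq> N z - {w}" "p \<in> P \<Longrightarrow> N p \<subseteq> N z - {w} - R" "card R \<le> 1"
proof -
  have w': "N w = {z, x}" "z \<noteq> x" using w by auto
  note x = degree2_reach[OF w] and z = degree2_reach[OF w']
  let ?Ix = "isol (N w \<union> N x)" and ?Iz = "isol (N w \<union> N z)"
  have wx: "w \<in> N x" "w \<in> N z" using w N_sym[of x w] N_sym[of z w] by auto
  have Iz: "p \<notin> N z" "p \<notin> {x, z}" "N p \<subseteq> insert x (N z - {w})" if "p \<in> ?Iz" for p
    using that z(4)[OF that] isolD[OF that] w by auto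
  show RZ: "R \<subseteq> N z - {w}" using wx unfolding R_def isol_def by auto
  have PZ: "N p \<subseteq> N z - {w} - R" if p: "p \<in> P" for p
  proof
    fix q assume q: "q \<in> N p"
    have p': "p \<in> ?Iz" "p \<notin> N x" using p unfolding P_def by auto
    have "q \<in> insert x (N z - {w})" using Iz(3)[OF p'(1)] q by auto
    moreover have "q \<noteq> x" using p' N_sym[OF q] by auto
    moreover have "q \<notin> R"
    proof
      assume "q \<in> R"
      then have "p \<in> insert z (N x - {w})" using x(4)[of q] N_sym[OF q] unfolding R_def by auto
      then show False using p' Iz(2)[of p] by auto
    qed
    ultimately show "q \<in> N z - {w} - R" by auto
  qed
  then show "p \<in> P \<Longrightarrow> N p \<subseteq> N z - {w} - R" .
  have "card (?Iz \<inter> N x) \<le> card (N x - {w})"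
    using wx by (intro card_mono) (auto simp: isol_def)
  then have "card (?Iz \<inter> N x) \<le> 3" using wx x(2) by simp
  moreover have "card ?Iz = card (?Iz \<inter> N x) + card P"
    unfolding P_def by (rule card_Int_Diff) simp
  ultimately have "card P \<noteq> 0" using z(3) by linarith
  then obtain p where p: "p \<in> P" by (cases "P = {}") auto
  have "2 \<le> card (N p)" using p min2 unfolding P_def isol_def by auto
  also have "\<dots> \<le> card (N z - {w} - R)" by (intro card_mono PZ p) auto
  also have "\<dots> = 3 - card R"
    using RZ wx z(2) finite_subset[OF RZ] by (simp add: card_Diff_subset)
  finally show "card R \<le> 1" by linarith
qed

text \<open>If some vertex isolated by \<open>wx\<close> is adjacent to \<open>z\<close>, a small
  dense part with a cheap edge is found among the vertices isolated by \<open>wz\<close> and their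
  neighbours; otherwise among those isolated by \<open>wx\<close> and their neighbours.\<close>

lemma no_degree2: "card (N w) \<noteq> 2"
proof
  assume "card (N w) = 2"
  then obtain x z where w: "N w = {x, z}" "x \<noteq> z" by (auto simp: card_2_iff)
  then have w': "N w = {z, x}" "z \<noteq> x" by auto
  note x = degree2_reach[OF w] and z = degree2_reach[OF w']
  define X where "X = N x - {w}"
  define Z where "Z = N z - {w}"
  define Ix where "Ix = isol (N w \<union> N x)"
  define Iz where "Iz = isol (N w \<union> N z)"
  define R where "R = Ix \<inter> N z"
  define P where "P = Iz - N x"
  have wx: "w \<in> N x" "w \<in> N z" using w N_sym[of x w] N_sym[of z w] by auto
  have fin: "finite X" "finite Z" "finite Ix" "finite Iz" "finite R" "finite P"
    unfolding X_def Z_def Ix_def Iz_def R_def P_def by auto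
  have XZ: "card X = 3" "card Z = 3" unfolding X_def Z_def using wx x(2) z(2) by auto
  have Ix: "p \<notin> N x" "p \<notin> {x, z}" "N p \<subseteq> insert z X" "2 \<le> card (N p)" if "p \<in> Ix" for p
    using that x(4)[of p] isolD[of p w x] w min2 unfolding Ix_def X_def by auto
  have RZ: "R \<subseteq> Z" "card R \<le> 1"
    using degree2_overlap(1,3)[OF w] unfolding R_def Z_def Ix_def by auto
  have PZ: "N p \<subseteq> Z - R" if "p \<in> P" for p
    using degree2_overlap(2)[OF w, of p] that unfolding R_def Z_def Ix_def P_def Iz_def by auto
  have P2: "2 \<le> card (N p)" if "p \<in> P" for p
    using min2[of p] that unfolding P_def Iz_def isol_def by auto
  \<comment> \<open>The overlap bound with the roles of \<open>x\<close> and \<open>z\<close>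
    exchanged.\<close>
  have "card (Iz \<inter> N x) \<le> 1"
    using degree2_overlap(3)[OF w'] unfolding Iz_def by auto
  moreover have "card Iz = card (Iz \<inter> N x) + card P"
    unfolding P_def by (rule card_Int_Diff[OF fin(4)])
  ultimately have P3: "3 \<le> card P" using z(3) unfolding Iz_def by linarith
  show False
  proof (cases "R = {}")
    case False
    then have R1: "card R = 1" using RZ(2) fin(5) by (simp add: le_Suc_eq)
    then have "card (Z - R) = 2" using RZ fin XZ by (simp add: card_Diff_subset)
    then obtain b c where bc: "Z - R = {b, c}" "b \<noteq> c" by (auto simp: card_2_iff)
    \<comment> \<open>All of \<open>P\<close> is joined to exactly \<open>b\<close> and
      \<open>c\<close>. The edge \<open>bp\<close> will then remove at most 6 vertices and isolate
      at most the single element of \<open>R\<close>.\<close>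
    have NP: "N p = {b, c}" if "p \<in> P" for p
      using card_seteq[of "{b, c}" "N p"] PZ[OF that] P2[OF that] bc by auto
    have zP: "z \<notin> P" "x \<notin> P" using w unfolding P_def Iz_def isol_def by auto
    have Nbc: "N y = insert z P" "card P = 3" if "y = b \<or> y = c" for y
    proof -
      have "y \<in> N z" using that bc unfolding Z_def by auto
      then have sub: "insert z P \<subseteq> N y" using NP that N_sym by blast
      have "4 \<le> card (insert z P)" using P3 zP fin by simp
      with N_eqI[OF sub] show "N y = insert z P" by simp
      then show "card P = 3" using N_card[of y] P3 zP fin by simp
    qed
    obtain p where p: "p \<in> P" using P3 by (cases "P = {}") auto
    have B: "N b \<union> N p = insert z P \<union> {b, c}" using Nbc NP[OF p] by auto
    have "isol (N b \<union> N p) \<subseteq> R"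
    proof
      fix r assume r: "r \<in> isol (N b \<union> N p)"
      then obtain q where q: "q \<in> N r" using isolD(6) by blast
      note r' = isolD[OF r]
      have bcz: "b \<in> N z" "c \<in> N z" using bc unfolding Z_def by auto
      have "x \<notin> N b \<union> N p" unfolding B using x(1) w zP bcz N_sym by blast
      then have "r \<noteq> w" using r' w by auto
      have rB: "r \<noteq> z" "r \<notin> P" "r \<noteq> b" "r \<noteq> c" using r' B by auto
      have "q \<notin> P" using NP[of q] N_sym[OF q] rB by auto
      moreover have "q \<noteq> b" "q \<noteq> c" using Nbc N_sym[OF q] rB by auto
      ultimately have "q = z" using q r' B by auto
      then have "r \<in> Z" using N_sym[OF q] \<open>r \<noteq> w\<close> unfolding Z_def by auto
      then show "r \<in> R" using bc rB by auto
    qed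
    then have "card (isol (N b \<union> N p)) \<le> 1" using card_mono[OF fin(5)] R1 by metis
    moreover have "card (N b \<union> N p) \<le> 6"
      unfolding B using Nbc(2)[of b] card_Un_le[of "insert z P" "{b, c}"] bc fin zP by simp
    moreover have "p \<in> N b" using Nbc p by auto
    ultimately show False using cost[of p b] by linarith
  next
    case True
    have IxX: "N p \<subseteq> X" if "p \<in> Ix" for p
    proof -
      have "z \<notin> N p" using True that N_sym[of z p] unfolding R_def by auto
      then show ?thesis using Ix(3)[OF that] by auto
    qed
    have Ix4: "4 \<le> card Ix" using x(3) unfolding Ix_def .
    have "2 * card Ix = (\<Sum>p\<in>Ix. 2)" by simp
    also have "\<dots> \<le> (\<Sum>p\<in>Ix. card (N p))" by (intro sum_mono Ix(4))
    also have "\<dots> = (\<Sum>y\<in>X. card (N y \<inter> Ix))"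
      by (intro sum_degree_eq IxX fin)
    finally have sum: "2 * card Ix \<le> (\<Sum>y\<in>X. card (N y \<inter> Ix))" .
    have y3: "card (N y \<inter> Ix) \<le> 3" if "y \<in> X" for y
      using card_inter_le[of "{x}" y Ix] N_sym[of y x] that Ix(2)[of x] unfolding X_def by auto
    have "(\<Sum>y\<in>X. card (N y \<inter> Ix)) \<le> (\<Sum>y\<in>X. 3)" by (intro sum_mono y3)
    then have Ix4': "card Ix = 4" using Ix4 sum XZ by simp
    \<comment> \<open>At least eight incidences are spread over the three vertices of
      \<open>X\<close>.\<close>
    have "\<exists>a\<in>X. 3 \<le> card (N a \<inter> Ix)"
    proof (rule ccontr)
      assume "\<not> ?thesis"
      then have "(\<Sum>y\<in>X. card (N y \<inter> Ix)) \<le> (\<Sum>y\<in>X. 2)" by (intro sum_mono) force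
      then show False using sum XZ Ix4 by simp
    qed
    then obtain a where a: "a \<in> X" "3 \<le> card (N a \<inter> Ix)" by blast
    have xIx: "x \<notin> Ix" using Ix(2) by blast
    have Na: "N a = insert x (N a \<inter> Ix)"
    proof (rule N_eqI)
      show "insert x (N a \<inter> Ix) \<subseteq> N a" using a N_sym[of a x] unfolding X_def by auto
      show "4 \<le> card (insert x (N a \<inter> Ix))" using a xIx fin by simp
    qed
    obtain p where p: "p \<in> N a" "p \<in> Ix" using a(2) by (cases "N a \<inter> Ix = {}") auto
    \<comment> \<open>The vertices removed and those isolated by the edge \<open>ap\<close> all stay
      inside this set of at most 8 elements, so the edge is cheap.\<close>
    let ?K = "insert x (Ix \<union> X)"
    have BK: "N a \<union> N p \<subseteq> ?K" using Na IxX[OF p(2)] by auto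
    have "isol (N a \<union> N p) \<subseteq> ?K"
    proof (rule ccontr)
      assume "\<not> ?thesis"
      then obtain r where r: "r \<in> isol (N a \<union> N p)" "r \<notin> ?K" by blast
      note r' = isolD[OF r(1)]
      have zK: "z \<notin> ?K" using x(1) w Ix(2)[of z] unfolding X_def by auto
      have "r \<noteq> w" using r'(5) BK zK w by auto
      have NrX: "N r \<subseteq> X"
      proof
        fix q assume q: "q \<in> N r"
        have "q \<noteq> x" using N_sym[OF q] r(2) \<open>r \<noteq> w\<close> unfolding X_def by auto
        moreover have "q \<notin> Ix" using IxX[of q] N_sym[OF q] r(2) by auto
        ultimately show "q \<in> X" using q r'(5) BK by auto
      qed
      moreover have "r \<noteq> z" using NrX wx unfolding X_def by auto
      moreover have "r \<notin> N x" using r(2) \<open>r \<noteq> w\<close> unfolding X_def by auto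
      ultimately have "r \<in> Ix" using r(2) r'(6) w unfolding Ix_def isol_def X_def by auto
      then show False using r(2) by auto
    qed
    then have "N a \<union> N p \<union> isol (N a \<union> N p) \<subseteq> ?K" using BK by auto
    then have "card (N a \<union> N p \<union> isol (N a \<union> N p)) \<le> card ?K"
      using fin by (intro card_mono) auto
    moreover have "card (N a \<union> N p \<union> isol (N a \<union> N p)) = card (N a \<union> N p) + card (isol (N a \<union> N p))"
      by (intro card_Un_disjoint finite_UnI finite_N finite_isol) (auto simp: isol_def)
    moreover have "card ?K \<le> 8"
      using card_Un_le[of Ix X] Ix4' XZ fin card_insert_le_m1[of 8 "Ix \<union> X" x] by simp
    ultimately show False using cost[OF p(1)] by linarith
  qed
qed

section \<open>Edges isolating a given vertex\<close>

lemma min3: "N v \<noteq> {} \<Longrightarrow> 3 \<le> card (N v)"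
  using min2[of v] no_degree2[of v] by linarith

definition graph_edges :: "'a set set" where
  "graph_edges = {{u, v} | u v. v \<in> N u}"

text \<open>Edges are unordered pairs, so each is counted once; for \<open>e = {u, v}\<close> the
  union is the removed set \<open>N u \<union> N v\<close>.\<close>

definition hit :: "'a \<Rightarrow> 'a set set" where
  "hit w = {e \<in> graph_edges. w \<in> isol (\<Union> (N ` e))}"

definition star :: "'a \<Rightarrow> 'a \<Rightarrow> 'a set set" where
  "star w u = {e \<in> hit w. u \<in> e}"

definition opp :: "'a \<Rightarrow> 'a \<Rightarrow> 'a set" where
  "opp w u = {v \<in> N u. w \<in> isol (N u \<union> N v)}"

lemma opp_sym: "v \<in> opp w u \<longleftrightarrow> u \<in> opp w v"
  unfolding opp_def using N_sym by (auto simp: Un_commute)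

lemma hit_iff: "{u, v} \<in> hit w \<longleftrightarrow> v \<in> opp w u"
  unfolding hit_def graph_edges_def opp_def using N_sym by (auto simp: doubleton_eq_iff)

lemma hitE:
  assumes "e \<in> hit w"
  obtains u v where "e = {u, v}" "v \<in> opp w u"
  using assms hit_iff unfolding hit_def graph_edges_def by blast

lemma finite_graph_edges [simp]: "finite graph_edges"
proof (rule finite_subset)
  show "graph_edges \<subseteq> Pow V" unfolding graph_edges_def using N_subset N_sym by blast
qed (simp add: finite_V)

lemma finite_hit [simp]: "finite (hit w)" "finite (star w u)"
  unfolding star_def hit_def by auto

lemma oppD:
  assumes "v \<in> opp w u"
  shows "v \<in> N u" "u \<in> N v" "v \<notin> N w" "u \<notin> N w" "w \<notin> N u" "w \<notin> N v" "N w \<subseteq> N u \<union> N v"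
    "v \<noteq> w" "u \<noteq> w" "v \<noteq> u"
  using assms N_sym N_irrefl unfolding opp_def isol_def by auto

lemma finite_opp [simp]: "finite (opp w u)"
  unfolding opp_def by simp

lemma star_eq: "star w u = (\<lambda>v. {u, v}) ` opp w u"
proof
  show "star w u \<subseteq> (\<lambda>v. {u, v}) ` opp w u"
  proof
    fix e assume e: "e \<in> star w u"
    then obtain a b where ab: "e = {a, b}" "b \<in> opp w a" unfolding star_def by (auto elim: hitE)
    then show "e \<in> (\<lambda>v. {u, v}) ` opp w u" using e opp_sym[of b w a] unfolding star_def by auto
  qed
  show "(\<lambda>v. {u, v}) ` opp w u \<subseteq> star w u" unfolding star_def by (auto simp: hit_iff)
qed

lemma hit_memE:
  assumes "e \<in> hit w" "u \<in> e"
  obtains v where "e = {u, v}" "v \<in> opp w u"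
proof -
  have "e \<in> star w u" using assms by (simp add: star_def)
  then show thesis using that unfolding star_eq by auto
qed

lemma card_star: "card (star w u) = card (opp w u)"
proof -
  have "inj_on (\<lambda>v. {u, v}) (opp w u)" by (auto simp: inj_on_def doubleton_eq_iff)
  then show ?thesis by (simp add: star_eq card_image)
qed

text \<open>An edge at \<open>u\<close> that isolates \<open>w\<close> has its other end outside
  \<open>N w\<close>, so these ends and the common neighbours of \<open>u\<close> and
  \<open>w\<close> compete for the four places at \<open>u\<close>.\<close>

lemma star_bound: "card (star w u) + card (N u \<inter> N w) \<le> 4"
proof -
  have "card (opp w u) + card (N u \<inter> N w) = card (opp w u \<union> (N u \<inter> N w))"
    by (intro card_Un_disjoint[symmetric]) (auto dest: oppD)
  also have "\<dots> \<le> card (N u)" by (intro card_mono) (auto simp: opp_def)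
  finally show ?thesis using N_card[of u] card_star by simp
qed

text \<open>The removed set must contain \<open>n\<close>, so \<open>n\<close> is adjacent to an end
  of \<open>e\<close>. Thus the at most three other neighbours of each \<open>n\<close> in
  \<open>N w\<close> form a vertex cover of \<open>hit w\<close>.\<close>

lemma hit_cover:
  assumes "e \<in> hit w" "n \<in> N w"
  shows "\<exists>u\<in>e. u \<in> N n - {w}"
proof -
  obtain u v where uv: "e = {u, v}" "v \<in> opp w u" using assms(1) by (rule hitE)
  then show ?thesis using oppD(7-9)[OF uv(2)] assms(2) N_sym by blast
qed

lemma card_reach: "n \<in> N w \<Longrightarrow> card (N n - {w}) \<le> 3"
  using N_sym[of n w] N_card[of n] by simp

lemma hit_le_sum:
  assumes "n \<in> N w"
  shows "card (hit w) \<le> (\<Sum>u\<in>N n - {w}. card (star w u))"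
proof -
  have "hit w \<subseteq> (\<Union>u\<in>N n - {w}. star w u)"
    using hit_cover[OF _ assms] unfolding star_def by auto
  then have "card (hit w) \<le> card (\<Union>u\<in>N n - {w}. star w u)" by (intro card_mono) auto
  also have "\<dots> \<le> (\<Sum>u\<in>N n - {w}. card (star w u))" by (intro card_UN_le) auto
  finally show ?thesis .
qed

section \<open>Forced neighbours, and the bound for degree 3\<close>

lemma third_neighbour:
  assumes "n \<in> N w" "v1 \<in> N n" "v2 \<in> N n" "v1 \<noteq> v2" "v1 \<noteq> w" "v2 \<noteq> w"
    and f: "f \<in> hit w" "v1 \<notin> f" "v2 \<notin> f"
  obtains y where "y \<in> f" "N n = {w, v1, v2, y}" "y \<notin> {w, v1, v2}"
proof -
  obtain y where y: "y \<in> f" "y \<in> N n" "y \<noteq> w" using hit_cover[OF f(1) assms(1)] by blast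
  then have ne: "y \<notin> {w, v1, v2}" using f by auto
  have "N n = {w, v1, v2, y}"
  proof (rule N_eqI)
    show "{w, v1, v2, y} \<subseteq> N n" using assms y N_sym by auto
    show "4 \<le> card {w, v1, v2, y}" using assms ne by auto
  qed
  then show thesis using that y ne by blast
qed

lemma hit_card2: "e \<in> hit w \<Longrightarrow> card e = 2"
  by (erule hitE) (auto dest: oppD)

text \<open>At least two edges of \<open>hit w\<close> avoid \<open>v1\<close> and
  \<open>v2\<close>. By \<open>third_neighbour\<close> the fourth neighbour of every
  \<open>n\<close> in \<open>M\<close> lies on both, and distinct edges share at most one vertex, so
  it is the same \<open>y\<close> for all of \<open>M\<close>.\<close>

lemma common_third:
  assumes v: "v1 \<noteq> v2" "v1 \<noteq> w" "v2 \<noteq> w"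
    and c: "card (star w v1) + card (star w v2) + 2 \<le> card (hit w)"
    and M: "M \<subseteq> N w" "M \<noteq> {}" "\<And>n. n \<in> M \<Longrightarrow> v1 \<in> N n \<and> v2 \<in> N n"
  obtains y where "\<And>n. n \<in> M \<Longrightarrow> N n = {w, v1, v2, y}" "y \<notin> {w, v1, v2}" "2 \<le> card (star w y)"
proof -
  let ?S = "hit w - (star w v1 \<union> star w v2)"
  have "card (hit w) - card (star w v1 \<union> star w v2) \<le> card ?S"
    by (intro diff_card_le_card_Diff) auto
  then have "2 \<le> card ?S" using card_Un_le[of "star w v1" "star w v2"] c by linarith
  then obtain f1 f2 where f: "f1 \<in> ?S" "f2 \<in> ?S" "f1 \<noteq> f2"
    by (metis card_le_Suc0_iff_eq finite_Diff finite_hit(1) not_less_eq_eq numeral_2_eq_2)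
  have f': "f1 \<in> hit w" "v1 \<notin> f1" "v2 \<notin> f1" "f2 \<in> hit w" "v1 \<notin> f2" "v2 \<notin> f2"
    using f unfolding star_def by auto
  have uniq: "y = y'" if "y \<in> f1" "y \<in> f2" "y' \<in> f1" "y' \<in> f2" for y y'
  proof (rule ccontr)
    assume "y \<noteq> y'"
    then have "f1 = {y, y'}" "f2 = {y, y'}"
      using hit_card2[OF f'(1)] hit_card2[OF f'(4)] that by (auto simp: card_2_iff)
    then show False using f by simp
  qed
  have ex: "\<exists>y. y \<in> f1 \<and> y \<in> f2 \<and> N n = {w, v1, v2, y} \<and> y \<notin> {w, v1, v2}" if n: "n \<in> M" for n
  proof -
    have n': "n \<in> N w" "v1 \<in> N n" "v2 \<in> N n" using M n by auto
    obtain y where y: "y \<in> f1" "N n = {w, v1, v2, y}" "y \<notin> {w, v1, v2}"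
      using third_neighbour[OF n' v f'(1-3)] .
    obtain y' where y': "y' \<in> f2" "N n = {w, v1, v2, y'}" "y' \<notin> {w, v1, v2}"
      using third_neighbour[OF n' v f'(4-6)] .
    have "y' = y" using y y' by auto
    then show ?thesis using y y' by blast
  qed
  obtain n0 where "n0 \<in> M" using M by blast
  then obtain y where y: "y \<in> f1" "y \<in> f2" "y \<notin> {w, v1, v2}" using ex by blast
  have "N n = {w, v1, v2, y}" if "n \<in> M" for n using ex[OF that] uniq y by blast
  moreover have "card {f1, f2} \<le> card (star w y)"
    using f' y unfolding star_def by (intro card_mono) auto
  ultimately show thesis using that y f by simp
qed

text \<open>With six such edges, a parity argument yields a vertex \<open>u\<close> with a single
  neighbour \<open>n1\<close> in \<open>N w\<close> and two edges in \<open>hit w\<close>. The other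
  two neighbours of \<open>w\<close> then share the neighbourhood \<open>{w, v1, v2, y}\<close>, and
  the edge from \<open>v1\<close> to one of them becomes cheap.\<close>

lemma hit_degree3:
  assumes w3: "card (N w) = 3"
  shows "card (hit w) \<le> 5"
proof (rule ccontr)
  assume "\<not> ?thesis"
  then have c6: "6 \<le> card (hit w)" by simp
  let ?D = "\<lambda>n. N n - {w}"
  \<comment> \<open>Otherwise every vertex of \<open>U\<close> has exactly two neighbours in
    \<open>N w\<close>, while there are 3 * 3 = 9 incidences between \<open>N w\<close> and
    \<open>U\<close>.\<close>
  have "\<exists>u. card (N u \<inter> N w) = 1 \<and> 2 \<le> card (star w u)"
  proof (rule ccontr)
    assume neg: "\<not> ?thesis"
    define U where "U = (\<Union>n\<in>N w. ?D n)"
    have fU: "finite U" unfolding U_def by auto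
    have le2: "card (star w u) \<le> 2" if "u \<in> U" for u
    proof -
      have "N u \<inter> N w \<noteq> {}" using that N_sym unfolding U_def by blast
      then have "card (N u \<inter> N w) \<noteq> 0" by simp
      moreover have "\<not> (card (N u \<inter> N w) = 1 \<and> 2 \<le> card (star w u))" using neg by blast
      ultimately show ?thesis using star_bound[of w u] by linarith
    qed
    have D: "card (?D n) = 3" "\<And>u. u \<in> ?D n \<Longrightarrow> card (star w u) = 2" if n: "n \<in> N w" for n
    proof -
      have l: "card (star w u) \<le> 2" if "u \<in> ?D n" for u using le2 that n unfolding U_def by blast
      have 1: "(\<Sum>u\<in>?D n. card (star w u)) \<le> (\<Sum>u\<in>?D n. 2)" by (intro sum_mono l)
      then show D3: "card (?D n) = 3"
        using hit_le_sum[OF n] c6 card_reach[OF n] by simp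
      have "(\<Sum>u\<in>?D n. card (star w u)) = (\<Sum>u\<in>?D n. 2)"
        using 1 hit_le_sum[OF n] c6 D3 by simp
      then show "card (star w u) = 2" if "u \<in> ?D n" for u
        using sum_mono_inv[OF _ l that] by auto
    qed
    have m: "card (N u \<inter> N w) = 2" if u: "u \<in> U" for u
    proof -
      have s: "card (star w u) = 2" using u D(2) unfolding U_def by blast
      have "card (N u \<inter> N w) \<noteq> 0" using u N_sym unfolding U_def by fastforce
      moreover have "\<not> (card (N u \<inter> N w) = 1 \<and> 2 \<le> card (star w u))" using neg by blast
      ultimately show ?thesis using star_bound[of w u] s by linarith
    qed
    have "(\<Sum>n\<in>N w. card (N n \<inter> U)) = (\<Sum>n\<in>N w. 3)"
    proof (rule sum.cong)
      fix n assume n: "n \<in> N w"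
      have "w \<notin> U" unfolding U_def by auto
      then have "N n \<inter> U = ?D n" using n unfolding U_def by auto
      then show "card (N n \<inter> U) = 3" using D[OF n] by simp
    qed simp
    moreover have "(\<Sum>n\<in>N w. card (N n \<inter> U)) = (\<Sum>u\<in>U. card (N u \<inter> N w))"
      by (intro sum_card_inter_swap fU) simp
    moreover have "\<dots> = 2 * card U" using m by simp
    ultimately have "2 * card U = 9" using w3 by simp
    then show False by presburger
  qed
  then obtain u where u: "card (N u \<inter> N w) = 1" "2 \<le> card (star w u)" by blast
  obtain n1 where n1: "N u \<inter> N w = {n1}" using u by (auto simp: card_1_singleton_iff)
  obtain v1 v2 where v: "v1 \<in> opp w u" "v2 \<in> opp w u" "v1 \<noteq> v2"
    using u(2) unfolding card_star
    by (metis card_le_Suc0_iff_eq finite_opp not_less_eq_eq numeral_2_eq_2)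
  define M where "M = N w - {n1}"
  have "n1 \<in> N w" using n1 by blast
  then have "card M = 2" unfolding M_def using w3 by simp
  then obtain n2 n3 where M: "M = {n2, n3}" "n2 \<noteq> n3" by (auto simp: card_2_iff)
  have Mv: "v1 \<in> N n \<and> v2 \<in> N n" if "n \<in> M" for n
    using that n1 oppD(7)[OF v(1)] oppD(7)[OF v(2)] N_sym unfolding M_def by blast
  have Mle: "card (star w y) \<le> 2" if "\<And>n. n \<in> M \<Longrightarrow> y \<in> N n" for y
  proof -
    have "card M \<le> card (N y \<inter> N w)"
      using that N_sym unfolding M_def by (intro card_mono) auto
    then show ?thesis using star_bound[of w y] \<open>card M = 2\<close> by simp
  qed
  have "card (star w v1) + card (star w v2) + 2 \<le> card (hit w)"
    using Mle[of v1] Mle[of v2] Mv c6 by fastforce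
  then obtain y where y: "\<And>n. n \<in> M \<Longrightarrow> N n = {w, v1, v2, y}" "y \<notin> {w, v1, v2}"
    using common_third[of v1 v2 w M] v oppD(8) M Mv unfolding M_def by (metis Diff_subset insert_not_empty)
  let ?Y = "{v1, v2, y}"
  have Yc: "card ?Y = 3" using y v by auto
  have n2: "N n2 = insert w ?Y" "N n3 = insert w ?Y" "n2 \<in> N w" "n3 \<in> N w" "n1 \<in> N w"
    using y M n1 unfolding M_def by auto
  have wY: "w \<notin> ?Y" using y v oppD(8) by blast
  have Yle: "card (star w q) \<le> 2" if "q \<in> ?Y" for q using Mle[of q] y that by auto
  \<comment> \<open>The cover \<open>?Y\<close> coming from \<open>n2\<close> has to carry at least
    six edges, so each of its three vertices carries exactly two.\<close>
  have "(\<Sum>q\<in>?Y. card (star w q)) \<le> (\<Sum>q\<in>?Y. 2)" by (intro sum_mono Yle)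
  moreover have "?D n2 = ?Y" using n2 wY by auto
  ultimately have "(\<Sum>q\<in>?Y. card (star w q)) = (\<Sum>q\<in>?Y. 2)"
    using hit_le_sum[OF n2(3)] c6 Yc by simp
  then have star2: "card (star w q) = 2" if "q \<in> ?Y" for q
    using sum_mono_inv[OF _ Yle that] by auto
  have NY: "N q = {n2, n3} \<union> opp w q" "card (opp w q) = 2" "n1 \<notin> N q" "q \<notin> N w" if q: "q \<in> ?Y" for q
  proof -
    have o: "card (opp w q) = 2" using star2[OF q] card_star by simp
    have Mq: "{n2, n3} \<subseteq> N q" using q n2 N_sym[of q n2] N_sym[of q n3] by auto
    have disj: "opp w q \<inter> N w = {}" by (auto dest: oppD)
    then show N: "N q = {n2, n3} \<union> opp w q"
    proof (intro N_eqI)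
      show "{n2, n3} \<union> opp w q \<subseteq> N q" using Mq by (auto simp: opp_def)
      have "card ({n2, n3} \<union> opp w q) = card {n2, n3} + card (opp w q)"
        using disj n2 by (intro card_Un_disjoint) auto
      then show "4 \<le> card ({n2, n3} \<union> opp w q)" using o M by simp
    qed
    show "card (opp w q) = 2" by (rule o)
    have "n1 \<notin> {n2, n3}" using M unfolding M_def by auto
    then show "n1 \<notin> N q" using N disj n2(5) by auto
    obtain s where "s \<in> opp w q" using o by (cases "opp w q = {}") auto
    then show "q \<notin> N w" by (rule oppD)
  qed
  have oppn1: "opp w q \<subseteq> ?D n1" if "q \<in> ?Y" for q
    using oppD(7,8) NY(3)[OF that] n2(5) N_sym by blast
  have Nw: "N w = {n1, n2, n3}" using M n2 unfolding M_def by auto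
  have wn2: "N w \<union> N n2 = {n1, n2, n3, w} \<union> ?Y" unfolding Nw n2 by auto
  have "card (N w \<union> N n2) \<le> 7" unfolding wn2 using card_length[of "[v1, v2, y, n1, n2, n3, w]"] by simp
  then have I3: "3 \<le> card (isol (N w \<union> N n2))" using isol_large[of n2 w 7] n2(3) by simp
  have "isol (N w \<union> N n2) \<subseteq> ?D n1"
  proof
    fix r assume r: "r \<in> isol (N w \<union> N n2)"
    note r' = isolD[OF r]
    obtain q where q: "q \<in> N r" using r' by blast
    have "r \<noteq> w" "q \<noteq> w" "q \<noteq> n2" "q \<noteq> n3" using r' q n2 wn2 N_sym[OF q] by auto
    moreover have "q \<in> {n1, n2, n3, w} \<union> ?Y" using q r' wn2 by auto
    ultimately consider "q = n1" | "q \<in> ?Y" by auto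
    then show "r \<in> ?D n1"
    proof cases
      case 1
      then show ?thesis using N_sym[OF q] \<open>r \<noteq> w\<close> by auto
    next
      case 2
      have "r \<in> opp w q" using NY(1)[OF 2] N_sym[OF q] r' wn2 by auto
      then show ?thesis using oppn1[OF 2] by auto
    qed
  qed
  \<comment> \<open>The edge from \<open>w\<close> to \<open>n2\<close> isolates at least three
    vertices, all of them among the at most three other neighbours of \<open>n1\<close>.\<close>
  then have IDn1: "isol (N w \<union> N n2) = ?D n1"
    using I3 card_reach[OF n2(5)] by (intro card_seteq) auto
  have D3: "card (?D n1) = 3" using IDn1 I3 card_reach[OF n2(5)] by simp
  have Dq: "N q \<subseteq> insert n1 ?Y" if "q \<in> ?D n1" for q
  proof
    fix s assume s: "s \<in> N q"
    note q' = isolD[of q w n2, unfolded IDn1, OF that]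
    have "s \<noteq> n3" "s \<noteq> n2" "s \<noteq> w" using q' N_sym[OF s] n2 s by auto
    then show "s \<in> insert n1 ?Y" using s q'(5) wn2 by auto
  qed
  have v1Y: "v1 \<in> ?Y" "v2 \<in> ?Y" "y \<in> ?Y" by auto
  \<comment> \<open>At most 8 vertices are removed by the edge from \<open>v1\<close> to
    \<open>n2\<close>, so some \<open>r\<close> would be isolated; what follows excludes every
    possible neighbour \<open>q\<close> of \<open>r\<close>.\<close>
  have B: "N v1 \<union> N n2 = {n2, n3, w} \<union> ?Y \<union> opp w v1" using NY(1)[OF v1Y(1)] n2 by auto
  have "card (N v1 \<union> N n2) \<le> 8"
    unfolding B using card_Un_le[of "{n2, n3, w} \<union> ?Y" "opp w v1"] NY(2)[OF v1Y(1)]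
      card_length[of "[v1, v2, y, n2, n3, w]"] by simp
  moreover have "n2 \<in> N v1" using NY(1)[OF v1Y(1)] by auto
  ultimately have "isol (N v1 \<union> N n2) \<noteq> {}" using isol_large[of n2 v1 8] by auto
  then obtain r where r: "r \<in> isol (N v1 \<union> N n2)" by blast
  note r' = isolD[OF r]
  obtain q where q: "q \<in> N r" using r' by blast
  have n1B: "n1 \<notin> N v1 \<union> N n2"
    unfolding B using oppn1[OF v1Y(1)] N_irrefl[of n1] NY(4) n2(5) M oppD(9)
      N_irrefl[of w] unfolding M_def by blast
  have rn1: "r \<noteq> n1"
  proof
    assume "r = n1"
    have "?D n1 \<subseteq> opp w v1"
    proof
      fix s assume s: "s \<in> ?D n1"
      then have "n1 \<in> N s" using N_sym by blast
      then have "s \<noteq> n2" "s \<noteq> n3" "s \<notin> ?Y" using n1B n2 NY(3)[of s] by auto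
      then show "s \<in> opp w v1" using s r'(5) B \<open>r = n1\<close> by auto
    qed
    then have "card (?D n1) \<le> card (opp w v1)" by (intro card_mono) auto
    then show False using D3 NY(2)[OF v1Y(1)] by simp
  qed
  have rD: "r \<notin> ?D n1" using n1B r'(5) N_sym[of r n1] by blast
  have rB: "r \<notin> {n2, n3, w} \<union> ?Y \<union> opp w v1" using r' B by auto
  have "q \<noteq> n2" "q \<noteq> n3" using N_sym[OF q] n2 rB by auto
  moreover have "q \<noteq> w" using N_sym[OF q] Nw rB rn1 by auto
  moreover have "q \<notin> ?Y" using NY(1)[of q] oppn1[of q] N_sym[OF q] rB rD by blast
  moreover have "q \<notin> opp w v1" using oppn1[OF v1Y(1)] Dq[of q] N_sym[OF q] rB rn1 by blast
  ultimately show False using r'(5) q B by auto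
qed

section \<open>The bound for vertices of degree 4\<close>

lemma opp_cover: "v \<in> opp w u \<Longrightarrow> N w - N u \<subseteq> N v"
  using oppD(7) by blast

text \<open>If \<open>u\<close> had at most one neighbour in \<open>N w\<close>, the ends
  \<open>v1\<close> and \<open>v2\<close> of two edges at \<open>u\<close> would be adjacent to the
  three or more remaining vertices of \<open>N w\<close> and carry at most one edge each. Then
  \<open>common_third\<close> gives a vertex \<open>y\<close> adjacent to the same vertices and
  carrying two edges, which exceeds its four places.\<close>

lemma star_two:
  assumes w4: "card (N w) = 4" and c4: "4 \<le> card (hit w)" and s2: "2 \<le> card (star w u)"
  shows "card (N u \<inter> N w) = 2" "card (opp w u) = 2" "N u = (N u \<inter> N w) \<union> opp w u"
proof -
  have "2 \<le> card (N u \<inter> N w)"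
  proof (rule ccontr)
    assume "\<not> ?thesis"
    define M where "M = N w - N u"
    have "card (N w) = card (N w \<inter> N u) + card M" unfolding M_def by (rule card_Int_Diff) simp
    then have M3: "3 \<le> card M" using w4 \<open>\<not> _\<close> by (simp add: Int_commute)
    have le1: "card (star w y) \<le> 1" if "\<And>n. n \<in> M \<Longrightarrow> y \<in> N n" for y
    proof -
      have "card M \<le> card (N y \<inter> N w)"
        using that N_sym unfolding M_def by (intro card_mono) auto
      then show ?thesis using star_bound[of w y] M3 by linarith
    qed
    obtain v1 v2 where v: "v1 \<in> opp w u" "v2 \<in> opp w u" "v1 \<noteq> v2"
      using s2 unfolding card_star
      by (metis card_le_Suc0_iff_eq finite_opp not_less_eq_eq numeral_2_eq_2)
    have Mv: "v1 \<in> N n \<and> v2 \<in> N n" if "n \<in> M" for n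
      using that opp_cover[OF v(1)] opp_cover[OF v(2)] N_sym unfolding M_def by blast
    have "card (star w v1) + card (star w v2) + 2 \<le> card (hit w)"
      using le1[of v1] le1[of v2] Mv c4 by fastforce
    moreover have "v1 \<noteq> w" "v2 \<noteq> w" using v oppD(8) by blast+
    moreover have "M \<subseteq> N w" unfolding M_def by auto
    moreover have "M \<noteq> {}" using M3 by auto
    ultimately obtain y where y: "\<And>n. n \<in> M \<Longrightarrow> N n = {w, v1, v2, y}" "2 \<le> card (star w y)"
      using common_third[of v1 v2 w M] v(3) Mv by metis
    then show False using le1[of y] by force
  qed
  then show "card (N u \<inter> N w) = 2" and o: "card (opp w u) = 2"
    using star_bound[of w u] s2 unfolding card_star by linarith+
  show "N u = (N u \<inter> N w) \<union> opp w u"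
  proof (rule N_eqI)
    show "N u \<inter> N w \<union> opp w u \<subseteq> N u" by (auto simp: opp_def)
    have "card (N u \<inter> N w \<union> opp w u) = card (N u \<inter> N w) + card (opp w u)"
      by (intro card_Un_disjoint) (auto dest: oppD)
    then show "4 \<le> card (N u \<inter> N w \<union> opp w u)" using \<open>2 \<le> card (N u \<inter> N w)\<close> o by simp
  qed
qed

lemma star_le_two:
  assumes "card (N w) = 4" "4 \<le> card (hit w)"
  shows "card (star w u) \<le> 2"
  using star_two(2)[OF assms, of u] card_star[of w u] by (cases "2 \<le> card (star w u)") auto

text \<open>
  \<open>v' - u - v - u'\<close> is a path in \<open>hit w\<close> whose inner vertices split \<open>N w\<close> into \<open>S\<close> and \<open>T\<close>.
\<close>

definition linked :: "'a \<Rightarrow> 'a \<Rightarrow> 'a \<Rightarrow> 'a \<Rightarrow> 'a \<Rightarrow> 'a set \<Rightarrow> 'a set \<Rightarrow> bool" where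
  "linked w u v v' u' S T \<longleftrightarrow>
     N w = S \<union> T \<and> S \<inter> T = {} \<and> card S = 2 \<and> card T = 2 \<and>
     N u = S \<union> {v, v'} \<and> N v = T \<union> {u, u'} \<and> opp w u = {v, v'} \<and> opp w v = {u, u'} \<and>
     v \<noteq> v' \<and> u \<noteq> u' \<and> S \<subseteq> N u' \<and> T \<subseteq> N v'"

lemma linked_sym: "linked w u v v' u' S T \<Longrightarrow> linked w v u u' v' T S"
  unfolding linked_def by auto

lemma card_2_other:
  assumes "card A = 2" "a \<in> A"
  obtains b where "A = {a, b}" "a \<noteq> b"
proof -
  obtain x y where "A = {x, y}" "x \<noteq> y" using assms(1) by (auto simp: card_2_iff)
  then show thesis using assms(2) that[of x] that[of y] by auto
qed

text \<open>By \<open>star_two\<close> each of \<open>u\<close> and \<open>v\<close> has exactly two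
  neighbours in \<open>N w\<close>. Together these cover the four elements of \<open>N w\<close>, so
  they partition it.\<close>

lemma obtain_linked:
  assumes w4: "card (N w) = 4" and c4: "4 \<le> card (hit w)" and vu: "v \<in> opp w u"
    and s2: "2 \<le> card (star w u)" "2 \<le> card (star w v)"
  obtains v' u' where "linked w u v v' u' (N u \<inter> N w) (N v \<inter> N w)"
proof -
  note u = star_two[OF w4 c4 s2(1)] and v = star_two[OF w4 c4 s2(2)]
  obtain v' where v': "opp w u = {v, v'}" "v \<noteq> v'" using card_2_other[OF u(2) vu] .
  have "u \<in> opp w v" using vu opp_sym by blast
  then obtain u' where u': "opp w v = {u, u'}" "u \<noteq> u'" using card_2_other[OF v(2)] by blast
  let ?S = "N u \<inter> N w" and ?T = "N v \<inter> N w"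
  have cov: "N w = ?S \<union> ?T" using oppD(7)[OF vu] by blast
  then have "card ?S + card ?T = card (?S \<union> ?T) + card (?S \<inter> ?T)"
    by (intro card_Un_Int) auto
  then have "card (?S \<inter> ?T) = 0" using u v w4 cov by simp
  then have disj: "?S \<inter> ?T = {}" by (simp add: card_eq_0_iff)
  have "?T \<subseteq> N v'" using opp_cover[of v' w u] v' disj by blast
  moreover have "?S \<subseteq> N u'" using opp_cover[of u' w v] u' disj by blast
  ultimately have "linked w u v v' u' ?S ?T"
    unfolding linked_def using cov disj u v u' v' by auto
  then show thesis by (rule that)
qed

lemma linked_isol:
  assumes l: "linked w u v v' u' S T" and r: "r \<in> isol (N u \<union> N v)"
  shows "N r \<subseteq> N w \<union> {v', u'}" "r \<notin> N w" "r \<notin> {u, v, u', v'}"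
  using isolD[OF r] l unfolding linked_def by auto

text \<open>The edge \<open>uv\<close> removes at most 8 vertices, so a cost of at least 10 requires
  two isolated vertices, and one of them differs from \<open>w\<close>.\<close>

lemma linked_other_isol:
  assumes l: "linked w u v v' u' S T"
  obtains r where "r \<in> isol (N u \<union> N v)" "r \<noteq> w"
proof -
  have B: "N u \<union> N v = S \<union> T \<union> {u, v, u', v'}" and ST: "card S = 2" "card T = 2"
    using l unfolding linked_def by auto
  have "card (S \<union> T \<union> {u, v, u', v'}) \<le> card S + card T + card {u, v, u', v'}"
    using card_Un_le[of "S \<union> T" "{u, v, u', v'}"] card_Un_le[of S T] by linarith
  then have "card (N u \<union> N v) \<le> 8" unfolding B using ST card_length[of "[u, v, u', v']"] by simp
  moreover have "v \<in> N u" using l unfolding linked_def by auto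
  ultimately have "2 \<le> card (isol (N u \<union> N v))" using isol_large[of v u 8] by simp
  then obtain r r' where "r \<in> isol (N u \<union> N v)" "r' \<in> isol (N u \<union> N v)" "r \<noteq> r'"
    by (metis card_le_Suc0_iff_eq finite_isol not_less_eq_eq numeral_2_eq_2)
  then show thesis using that by metis
qed

text \<open>
  Here \<open>r - v' - u - v - u'\<close> is a path in \<open>hit w\<close>.  A fifth edge must extend it beyond \<open>u'\<close>, and then
  the end edge \<open>r v'\<close> is cheap.
\<close>

lemma hit5_path_False:
  assumes w4: "card (N w) = 4" and c5: "5 \<le> card (hit w)"
    and l: "linked w u v v' u' S T"
    and r: "r \<in> isol (N u \<union> N v)" "r \<noteq> w" "v' \<in> opp w r"
  shows False
proof -
  note L = l[unfolded linked_def]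
  have Nw: "N w = S \<union> T" and disj: "S \<inter> T = {}" and Su': "S \<subseteq> N u'" and Tv': "T \<subseteq> N v'"
    and uu': "u \<noteq> u'" "v \<noteq> v'" and cST: "card S = 2" "card T = 2"
    and Nu: "N u = S \<union> {v, v'}" and Nv: "N v = T \<union> {u, u'}"
    and ou: "opp w u = {v, v'}" and ov: "opp w v = {u, u'}"
    using L by simp_all
  have c4: "4 \<le> card (hit w)" using c5 by simp
  note rl = linked_isol[OF l r(1)]
  have ne: "u \<noteq> v" "v' \<noteq> w" "u' \<noteq> w" "u \<noteq> w" "v \<noteq> w" "u \<notin> N w" "v \<notin> N w" "u' \<notin> N w" "v' \<notin> N w"
    using ou ov oppD[of v w u] oppD[of v' w u] oppD[of u' w v] by auto
  have ov': "{u, r} \<subseteq> opp w v'" using r(3) ou opp_sym[of v' w u] opp_sym[of v' w r] by simp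
  have ur: "u \<noteq> r" using rl by auto
  have "card {u, r} \<le> card (opp w v')" by (intro card_mono ov') auto
  then have "2 \<le> card (star w v')" using ur card_star by simp
  note v'2 = star_two[OF w4 c4 this]
  have opv': "opp w v' = {u, r}" using card_seteq[of "opp w v'" "{u, r}"] ov' v'2(2) ur by auto
  have "T \<subseteq> N v' \<inter> N w" using Nw Tv' by auto
  then have "T = N v' \<inter> N w" using card_seteq[of "N v' \<inter> N w" T] v'2(1) cST by auto
  then have Nv': "N v' = T \<union> {u, r}" using v'2(3) opv' by simp
  have STne: "S \<noteq> {}" "T \<noteq> {}" "finite S" "finite T" using cST by (auto intro: card_ge_0_finite)
  have Sr: "S \<subseteq> N r"
  proof -
    have "r \<in> opp w v'" using opv' by simp
    then have "N w - N v' \<subseteq> N r" by (rule opp_cover)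
    moreover have "S \<inter> N v' = {}" using \<open>T = _\<close> Nw disj by blast
    ultimately show ?thesis using Nw by blast
  qed
  have ur': "u' \<noteq> r" "r \<noteq> v" "r \<noteq> v'" using rl by auto
  have NS: "N n = {w, u, u', r}" if n: "n \<in> S" for n
  proof (rule N_eqI)
    show "{w, u, u', r} \<subseteq> N n" using n Nw Nu Su' Sr N_sym[of n] by auto
    show "4 \<le> card {w, u, u', r}" using ne ur ur' r uu' by auto
  qed
  have u'v': "u' \<noteq> v'"
  proof
    assume "u' = v'"
    then have "S \<subseteq> T \<union> {u, r}" using Su' Nv' by simp
    then show False using STne(1) disj Nw ne(6) rl(2) by auto
  qed
  have ed: "star w u = {{u, v}, {u, v'}}" "star w v = {{u, v}, {v, u'}}" "star w v' = {{u, v'}, {v', r}}"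
    unfolding star_eq ou ov opv' by (auto simp: insert_commute)
  \<comment> \<open>The path has four edges, so there is a further edge \<open>f\<close>. It avoids
    \<open>u\<close>, \<open>v\<close> and \<open>v'\<close>, whose two edges all belong to the
    path.\<close>
  have "card {{u, v}, {u, v'}, {v, u'}, {v', r}} \<le> 4"
    using card_length[of "[{u, v}, {u, v'}, {v, u'}, {v', r}]"] by simp
  then have "\<not> hit w \<subseteq> {{u, v}, {u, v'}, {v, u'}, {v', r}}"
    using c5 card_mono[of "{{u, v}, {u, v'}, {v, u'}, {v', r}}" "hit w"] by fastforce
  then obtain f where f: "f \<in> hit w" "f \<notin> {{u, v}, {u, v'}, {v, u'}, {v', r}}" by blast
  have "f \<notin> star w u" "f \<notin> star w v" "f \<notin> star w v'" unfolding ed using f by simp_all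
  then have fn: "u \<notin> f" "v \<notin> f" "v' \<notin> f" using f(1) by (simp_all add: star_def)
  have oppr: "opp w r \<subseteq> {v', u'}" using rl(1) oppD(1,3) by blast
  have "u' \<in> f"
  proof (rule ccontr)
    assume nu': "u' \<notin> f"
    obtain n where "n \<in> S" using STne by blast
    then obtain x where "x \<in> f" "x \<in> {u, u', r}" using hit_cover[OF f(1), of n] NS[of n] Nw by auto
    then have "r \<in> f" using fn nu' by auto
    then obtain h where "f = {r, h}" "h \<in> opp w r" using f(1) by (elim hit_memE) auto
    then show False using oppr fn nu' by auto
  qed
  then obtain y where y: "f = {u', y}" "y \<in> opp w u'"
    using f(1) by (elim hit_memE) auto
  have yne: "y \<noteq> v" "y \<notin> N w" "y \<noteq> u" "y \<noteq> v'" "y \<in> N u'" "y \<noteq> w"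
    using y fn oppD[OF y(2)] by auto
  have NTu': "n \<notin> N u'" if n: "n \<in> T" for n
  proof
    assume "n \<in> N u'"
    then have sub: "S \<union> {n, v, y} \<subseteq> N u'" using Su' Nv yne N_sym[of u' v] by auto
    have "card (S \<union> {n, v, y}) = card S + card {n, v, y}"
      using n Nw disj yne ne STne by (intro card_Un_disjoint) auto
    moreover have "n \<noteq> v" "n \<noteq> y" using n Nw ne(7) yne(2) by auto
    then have "card {n, v, y} = 3" using yne(1) by simp
    ultimately have "card (S \<union> {n, v, y}) = 5" using cST by simp
    then show False using card_mono[OF finite_N sub] N_card[of u'] by simp
  qed
  have NT: "N n = {w, v, v', y}" if n: "n \<in> T" for n
  proof -
    have n': "n \<in> N w" "v \<in> N n" "v' \<in> N n" using n Nw Nv Nv' N_sym[of n] by auto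
    obtain y' where y': "y' \<in> f" "N n = {w, v, v', y'}" "y' \<notin> {w, v, v'}"
      using third_neighbour[OF n' uu'(2) ne(5,2) f(1) fn(2,3)] .
    have "y' \<noteq> u'" using NTu'[OF n] y' N_sym[of u' n] by blast
    then show ?thesis using y y' by auto
  qed
  have yr: "y \<noteq> r"
  proof
    assume "y = r"
    then have sub: "S \<union> T \<union> {v'} \<subseteq> N r" using Sr NT N_sym[of r] oppD(1)[OF r(3)] by auto
    have "card (S \<union> T \<union> {v'}) = 5" using ne(9) w4 STne unfolding Nw by simp
    then show False using card_mono[OF finite_N sub] N_card[of r] by simp
  qed
  have Nu': "N u' = S \<union> {v, y}"
  proof (rule N_eqI)
    show "S \<union> {v, y} \<subseteq> N u'" using Su' Nv yne N_sym[of u' v] by auto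
    have "card (S \<union> {v, y}) = card S + card {v, y}"
      using Nw ne yne STne by (intro card_Un_disjoint) auto
    then show "4 \<le> card (S \<union> {v, y})" using cST yne by auto
  qed
  have "u' \<notin> N r" using N_sym[of u' r] Nu' ur' yr rl(2) Nw by auto
  moreover have "N r \<inter> T = {}" using NT N_sym[of _ r] r(2) ur' yr by fastforce
  ultimately have Nr: "N r \<subseteq> S \<union> {v'}" using rl(1) Nw by auto
  have B: "N r \<union> N v' \<subseteq> S \<union> T \<union> {v', u, r}" using Nr Nv' by auto
  have "card (S \<union> T \<union> {v', u, r}) \<le> card (S \<union> T) + card {v', u, r}" by (rule card_Un_le)
  also have "\<dots> \<le> 7" using w4 Nw card_length[of "[v', u, r]"] by simp
  finally have "card (N r \<union> N v') \<le> 7" using card_mono[OF _ B] STne by simp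
  then have "3 \<le> card (isol (N r \<union> N v'))" using isol_large[OF oppD(1)[OF r(3)], of 7] by simp
  then have "\<not> isol (N r \<union> N v') \<subseteq> {w}"
    using card_mono[of "{w}" "isol (N r \<union> N v')"] by auto
  then obtain q where q: "q \<in> isol (N r \<union> N v')" "q \<noteq> w" by blast
  note q' = isolD[OF q(1)]
  \<comment> \<open>\<open>q\<close> is adjacent neither to \<open>r\<close> nor to
    \<open>v'\<close>; if it also missed \<open>S\<close> and \<open>T\<close>, its only neighbour
    would be \<open>u\<close>, against the minimum degree 3.\<close>
  have "\<not> N q \<subseteq> {u}" using min3[OF q'(6)] card_mono[of "{u}" "N q"] by auto
  then obtain n where n: "n \<in> N q" "n \<in> S \<union> T" using q' B by auto
  have q'': "q \<noteq> u" "q \<noteq> r" "q \<noteq> v'"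
    using q' Nv' oppD(1)[OF r(3)] by auto
  have "q \<in> N n" using n N_sym by blast
  \<comment> \<open>Each of these three has a neighbour, \<open>v\<close> or \<open>u'\<close>,
    outside the removed set and is therefore not isolated.\<close>
  then have "q \<in> {u', v, y}" using NS NT n q'' q(2) by auto
  moreover have "q \<noteq> v" "q \<noteq> u'" "q \<noteq> y"
  proof -
    have nB: "u' \<notin> N r \<union> N v'" using B Nw ne u'v' ur' uu' by auto
    have "v \<notin> N r \<union> N v'" using B Nw ne ur' uu' by auto
    then show "q \<noteq> u'" using q' Nu' by auto
    show "q \<noteq> v" using q' nB Nv by auto
    show "q \<noteq> y" using q' nB N_sym[OF yne(5)] by auto
  qed
  ultimately show False by auto
qed

text \<open>With five edges, of which a vertex carries at most two, every cover of at most three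
  vertices is tight: each of its vertices carries an edge, and of any two at least one carries two.
  This yields a path with three edges and then the extension excluded by
  \<open>hit5_path_False\<close>.\<close>

lemma hit_degree4:
  assumes w4: "card (N w) = 4"
  shows "card (hit w) \<le> 4"
proof (rule ccontr)
  assume "\<not> ?thesis"
  then have c5: "5 \<le> card (hit w)" by simp
  then have c4: "4 \<le> card (hit w)" by simp
  note le2 = star_le_two[OF w4 c4]
  have drop: "(\<Sum>q\<in>N n - {w} - A. card (star w q)) \<ge> 5 - (\<Sum>q\<in>A. card (star w q))"
    if "n \<in> N w" "A \<subseteq> N n - {w}" for n A
    using hit_le_sum[OF that(1)] c5 sum.subset_diff[OF that(2), of "\<lambda>q. card (star w q)"] by simp
  have pos: "1 \<le> card (star w q)" if n: "n \<in> N w" "q \<in> N n - {w}" for n q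
  proof -
    have "(\<Sum>x\<in>N n - {w} - {q}. card (star w x)) \<le> (\<Sum>x\<in>N n - {w} - {q}. 2)"
      by (intro sum_mono le2)
    moreover have "card (N n - {w} - {q}) \<le> 2" using card_reach[OF n(1)] n(2) by simp
    ultimately show ?thesis using drop[of n "{q}"] n by simp
  qed
  have big: "\<exists>x\<in>A. 2 \<le> card (star w x)"
    if n: "n \<in> N w" and A: "A \<subseteq> N n - {w}" "card A = 2" for n A
  proof (rule ccontr)
    assume neg: "\<not> ?thesis"
    have "(\<Sum>x\<in>N n - {w} - A. card (star w x)) \<le> (\<Sum>x\<in>N n - {w} - A. 2)"
      by (intro sum_mono le2)
    moreover have "(\<Sum>x\<in>A. card (star w x)) \<le> (\<Sum>x\<in>A. 1)" using neg by (intro sum_mono) force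
    moreover have "card (N n - {w} - A) \<le> 1"
      using card_reach[OF n] A finite_subset[OF A(1)] by (simp add: card_Diff_subset)
    ultimately show False using drop[OF n A(1)] A(2) by simp
  qed
  obtain n1 where n1: "n1 \<in> N w" using w4 by (cases "N w = {}") auto
  have "\<exists>u\<in>N n1 - {w}. 2 \<le> card (star w u)"
  proof (rule ccontr)
    assume neg: "\<not> ?thesis"
    have "(\<Sum>x\<in>N n1 - {w}. card (star w x)) \<le> (\<Sum>x\<in>N n1 - {w}. 1)"
      using neg by (intro sum_mono) force
    then show False using hit_le_sum[OF n1] c5 card_reach[OF n1] by simp
  qed
  then obtain u where u: "2 \<le> card (star w u)" by blast
  note u2 = star_two[OF w4 c4 u]
  have "N w - N u \<noteq> {}"
  proof
    assume "N w - N u = {}"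
    then have "N u \<inter> N w = N w" by auto
    then show False using u2 w4 by simp
  qed
  then obtain n3 where n3: "n3 \<in> N w" "n3 \<notin> N u" by blast
  \<comment> \<open>Both vertices opposite to \<open>u\<close> belong to the cover given by
    \<open>n3\<close>, so one of them carries two edges.\<close>
  have "opp w u \<subseteq> N n3 - {w}" using opp_cover n3 N_sym oppD(8) by blast
  then obtain v where v: "v \<in> opp w u" "2 \<le> card (star w v)" using big[OF n3(1) _ u2(2)] by blast
  obtain v' u' where l: "linked w u v v' u' (N u \<inter> N w) (N v \<inter> N w)"
    using obtain_linked[OF w4 c4 v(1) u v(2)] .
  obtain r where r: "r \<in> isol (N u \<union> N v)" "r \<noteq> w" using linked_other_isol[OF l] .
  note rl = linked_isol[OF l r(1)]
  \<comment> \<open>Having degree at least 3, \<open>r\<close> must have a neighbour in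
    \<open>N w\<close>; so it belongs to a cover and carries an edge of
    \<open>hit w\<close>.\<close>
  have "\<not> N r \<subseteq> {v', u'}"
  proof
    assume "N r \<subseteq> {v', u'}"
    then have "card (N r) \<le> card {v', u'}" by (intro card_mono) auto
    then show False using min3[OF isolD(6)[OF r(1)]] card_length[of "[v', u']"] by simp
  qed
  then obtain n where n: "n \<in> N w" "n \<in> N r" using rl(1) by blast
  then have "1 \<le> card (star w r)" using pos r(2) N_sym by blast
  then have "opp w r \<noteq> {}" unfolding card_star by auto
  then obtain c where c: "c \<in> opp w r" by blast
  then have "c = v' \<or> c = u'" using rl(1) oppD(1,3)[OF c] by blast
  then show False
    using hit5_path_False[OF w4 c5 l r] hit5_path_False[OF w4 c5 linked_sym[OF l], of r] r c
    by (auto simp: Un_commute)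
qed

end

section \<open>Double counting\<close>

text \<open>\<open>C25\<close> in terms of neighbourhoods: five disjoint pairs in cyclic order, with
  \<open>i + 4\<close> in place of \<open>i - 1\<close> modulo 5. The equations prescribe full
  neighbourhoods, so the union of the pairs is closed under adjacency.\<close>

definition blowup5 :: "('a \<Rightarrow> 'a set) \<Rightarrow> bool" where
  "blowup5 N \<longleftrightarrow> (\<exists>X :: nat \<Rightarrow> 'a set.
     (\<forall>i<5. card (X i) = 2) \<and>
     (\<forall>i<5. \<forall>j<5. i \<noteq> j \<longrightarrow> X i \<inter> X j = {}) \<and>
     (\<forall>i<5. \<forall>x\<in>X i. N x = X ((i + 1) mod 5) \<union> X ((i + 4) mod 5)))"

lemma less_5_cases: "(i::nat) < 5 \<longleftrightarrow> i = 0 \<or> i = 1 \<or> i = 2 \<or> i = 3 \<or> i = 4"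
  by auto

lemma blowup5I:
  assumes "card A = 2" "card B = 2" "card C = 2" "card D = 2" "card E = 2"
    and "A \<inter> B = {}" "A \<inter> C = {}" "A \<inter> D = {}" "A \<inter> E = {}" "B \<inter> C = {}" "B \<inter> D = {}"
      "B \<inter> E = {}" "C \<inter> D = {}" "C \<inter> E = {}" "D \<inter> E = {}"
    and "\<And>x. x \<in> A \<Longrightarrow> N x = B \<union> E" "\<And>x. x \<in> B \<Longrightarrow> N x = C \<union> A" "\<And>x. x \<in> C \<Longrightarrow> N x = D \<union> B"
      "\<And>x. x \<in> D \<Longrightarrow> N x = E \<union> C" "\<And>x. x \<in> E \<Longrightarrow> N x = A \<union> D"
  shows "blowup5 N"
  unfolding blowup5_def
proof (intro exI[of _ "\<lambda>i. [A, B, C, D, E] ! i"] conjI)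
  show "\<forall>i<5. card ([A, B, C, D, E] ! i) = 2" using assms(1-5) by (auto simp: less_5_cases)
  show "\<forall>i<5. \<forall>j<5. i \<noteq> j \<longrightarrow> [A, B, C, D, E] ! i \<inter> [A, B, C, D, E] ! j = {}"
    using assms(6-15) by (auto simp: less_5_cases)
  show "\<forall>i<5. \<forall>x\<in>[A, B, C, D, E] ! i.
      N x = [A, B, C, D, E] ! ((i + 1) mod 5) \<union> [A, B, C, D, E] ! ((i + 4) mod 5)"
    using assms(16-20) by (auto simp: less_5_cases)
qed

context costly_graph
begin

lemma sum_over_edges:
  fixes f :: "'a \<Rightarrow> nat"
  shows "(\<Sum>e\<in>graph_edges. \<Sum>v\<in>e. f v) = (\<Sum>v\<in>{v. N v \<noteq> {}}. f v * card (N v))"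
proof -
  let ?A = "{v. N v \<noteq> {}}"
  have fA: "finite ?A"
    by (rule finite_subset[OF _ finite_V]) (use N_subset N_sym in blast)
  have eA: "e \<subseteq> ?A" if "e \<in> graph_edges" for e
    using that N_sym unfolding graph_edges_def by blast
  have d: "card {e \<in> graph_edges. v \<in> e} = card (N v)" for v
  proof -
    have "{e \<in> graph_edges. v \<in> e} = (\<lambda>u. {v, u}) ` N v"
      unfolding graph_edges_def using N_sym by (auto simp: insert_commute)
    moreover have "inj_on (\<lambda>u. {v, u}) (N v)" by (auto simp: inj_on_def doubleton_eq_iff)
    ultimately show ?thesis by (simp add: card_image)
  qed
  have "(\<Sum>e\<in>graph_edges. \<Sum>v\<in>e. f v) = (\<Sum>e\<in>graph_edges. \<Sum>v\<in>?A. if v \<in> e then f v else 0)"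
  proof (rule sum.cong[OF refl])
    fix e assume "e \<in> graph_edges"
    then have "?A \<inter> e = e" using eA by blast
    then show "(\<Sum>v\<in>e. f v) = (\<Sum>v\<in>?A. if v \<in> e then f v else 0)"
      using sum.inter_restrict[OF fA, of f e] by simp
  qed
  also have "\<dots> = (\<Sum>v\<in>?A. \<Sum>e\<in>graph_edges. if v \<in> e then f v else 0)" by (rule sum.swap)
  also have "\<dots> = (\<Sum>v\<in>?A. f v * card (N v))"
  proof (rule sum.cong[OF refl])
    fix v
    have "(\<Sum>e\<in>graph_edges. if v \<in> e then f v else 0) = (\<Sum>e\<in>{e \<in> graph_edges. v \<in> e}. f v)"
      by (intro sum.inter_filter[symmetric] finite_graph_edges)
    then show "(\<Sum>e\<in>graph_edges. if v \<in> e then f v else 0) = f v * card (N v)"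
      by (simp add: d)
  qed
  finally show ?thesis .
qed

text \<open>The cost bound is summed over all edges, and five of the required 10 are charged to each
  end. A vertex of degree d with h edges in its \<open>hit\<close> set then compares 5 * d with d *
  d + h, which is at most 14 < 15 for d = 3 and at most 20 for d = 4. Hence degree 3 does not occur
  and all inequalities are equalities.\<close>

lemma regular_tight:
  shows "N w \<noteq> {} \<Longrightarrow> card (N w) = 4" "N w \<noteq> {} \<Longrightarrow> card (hit w) = 4"
    "v \<in> N u \<Longrightarrow> N u \<inter> N v = {}"
proof -
  let ?A = "{v. N v \<noteq> {}}" and ?I = "\<lambda>e. isol (\<Union> (N ` e))"
  have fA: "finite ?A"
    by (rule finite_subset[OF _ finite_V]) (use N_subset N_sym in blast)
  have le: "10 \<le> (\<Sum>v\<in>e. card (N v)) + card (?I e)" if e: "e \<in> graph_edges" for e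
  proof -
    obtain u v where uv: "e = {u, v}" "v \<in> N u" using e unfolding graph_edges_def by blast
    then have "u \<noteq> v" using N_irrefl by blast
    then show ?thesis using cost[OF uv(2)] card_Un_le[of "N u" "N v"] uv(1) by simp
  qed
  have pt: "card (N v) * card (N v) + card (hit v) \<le> 5 * card (N v)
      \<and> (card (N v) * card (N v) + card (hit v) = 5 * card (N v) \<longrightarrow> card (N v) = 4)"
    if "v \<in> ?A" for v
  proof -
    have "card (N v) = 3 \<or> card (N v) = 4" using that min3[of v] N_card[of v] by auto
    then show ?thesis using hit_degree3[of v] hit_degree4[of v] by auto
  qed
  have "(\<Sum>e\<in>graph_edges. card (?I e)) = (\<Sum>e\<in>graph_edges. card {w \<in> ?A. w \<in> ?I e})"
    by (intro sum.cong refl arg_cong[of _ _ card]) (auto simp: isol_def)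
  also have "\<dots> = (\<Sum>w\<in>?A. card (hit w))"
    by (intro sum_multicount_gen fA finite_graph_edges) (auto simp: hit_def)
  finally have I: "(\<Sum>e\<in>graph_edges. card (?I e)) = (\<Sum>w\<in>?A. card (hit w))" .
  have "(\<Sum>e\<in>graph_edges. 10 :: nat) = (\<Sum>e\<in>graph_edges. 5 * (\<Sum>v\<in>e. 1))"
  proof (rule sum.cong[OF refl])
    fix e assume "e \<in> graph_edges"
    then obtain u v where uv: "e = {u, v}" "v \<in> N u" unfolding graph_edges_def by blast
    then have "u \<noteq> v" using N_irrefl by blast
    then show "10 = 5 * (\<Sum>v\<in>e. 1 :: nat)" using uv by simp
  qed
  also have "\<dots> = (\<Sum>v\<in>?A. 5 * card (N v))"
    using sum_over_edges[of "\<lambda>_. 1"] by (simp add: sum_distrib_left[symmetric])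
  finally have 1: "(\<Sum>e\<in>graph_edges. 10) = (\<Sum>v\<in>?A. 5 * card (N v))" .
  have 2: "(\<Sum>e\<in>graph_edges. (\<Sum>v\<in>e. card (N v)) + card (?I e))
      = (\<Sum>v\<in>?A. card (N v) * card (N v) + card (hit v))"
    using sum_over_edges[of "\<lambda>v. card (N v)"] I by (simp add: sum.distrib)
  have 3: "(\<Sum>e\<in>graph_edges. 10) \<le> (\<Sum>e\<in>graph_edges. (\<Sum>v\<in>e. card (N v)) + card (?I e))"
    by (intro sum_mono le)
  have 4: "(\<Sum>v\<in>?A. card (N v) * card (N v) + card (hit v)) \<le> (\<Sum>v\<in>?A. 5 * card (N v))"
    using pt by (intro sum_mono) blast
  have eqA: "card (N v) * card (N v) + card (hit v) = 5 * card (N v)" if "v \<in> ?A" for v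
  proof (rule sum_mono_inv[of _ ?A])
    show "(\<Sum>v\<in>?A. card (N v) * card (N v) + card (hit v)) = (\<Sum>v\<in>?A. 5 * card (N v))"
      using 1 2 3 4 by linarith
  qed (use pt that fA in blast)+
  have d4: "card (N v) = 4" if "N v \<noteq> {}" for v using pt[of v] eqA[of v] that by blast
  then show "card (N w) = 4" if "N w \<noteq> {}" using that .
  show "card (hit w) = 4" if "N w \<noteq> {}" using d4[of w] eqA[of w] that by simp
  have eqE: "10 = (\<Sum>v\<in>e. card (N v)) + card (?I e)" if "e \<in> graph_edges" for e
  proof (rule sum_mono_inv[of "\<lambda>_. 10" graph_edges "\<lambda>e. (\<Sum>v\<in>e. card (N v)) + card (?I e)"])
    show "(\<Sum>e\<in>graph_edges. 10) = (\<Sum>e\<in>graph_edges. (\<Sum>v\<in>e. card (N v)) + card (?I e))"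
      using 1 2 3 4 by linarith
  qed (use le that finite_graph_edges in blast)+
  show "N u \<inter> N v = {}" if v: "v \<in> N u"
  proof -
    have e: "{u, v} \<in> graph_edges" using v unfolding graph_edges_def by blast
    have ne: "u \<noteq> v" using v N_irrefl by blast
    have d: "card (N u) = 4" "card (N v) = 4" using v N_sym[OF v] by (auto intro!: d4)
    \<comment> \<open>This equality has the degree sum where \<open>cost\<close> has the size of the
      union, so the union must have 8 elements.\<close>
    have "10 = 8 + card (isol (N u \<union> N v))" using eqE[OF e] ne d by simp
    then have "8 \<le> card (N u \<union> N v)" using cost[OF v] by linarith
    moreover have "card (N u) + card (N v) = card (N u \<union> N v) + card (N u \<inter> N v)"
      by (intro card_Un_Int) auto
    ultimately have "card (N u \<inter> N v) = 0" using d by linarith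
    then show ?thesis by (simp add: card_eq_0_iff)
  qed
qed

text \<open>A second vertex \<open>r\<close> isolated by \<open>uv\<close> has the same
  neighbourhood as \<open>w\<close>, and the fourth edge of \<open>hit w\<close> joins
  \<open>u'\<close> and \<open>v'\<close>. The pairs \<open>{w, r}\<close>, \<open>S\<close>,
  \<open>{u, u'}\<close>, \<open>{v, v'}\<close>, \<open>T\<close> then form the blow-up.\<close>

lemma linked_blowup5:
  assumes w0: "N w \<noteq> {}" and l: "linked w u v v' u' S T"
  shows "blowup5 N"
proof -
  note tf = regular_tight(3) and w4 = regular_tight(1)[OF w0] and h4 = regular_tight(2)[OF w0]
  have Nw: "N w = S \<union> T" and disj: "S \<inter> T = {}" and Su': "S \<subseteq> N u'" and Tv': "T \<subseteq> N v'"
    and uu': "u \<noteq> u'" "v \<noteq> v'" and cST: "card S = 2" "card T = 2"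
    and Nu: "N u = S \<union> {v, v'}" and Nv: "N v = T \<union> {u, u'}"
    and ou: "opp w u = {v, v'}" and ov: "opp w v = {u, u'}"
    using l[unfolded linked_def] by simp_all
  have STne: "S \<noteq> {}" "T \<noteq> {}" "finite S" "finite T" using cST by (auto intro: card_ge_0_finite)
  have ne: "u \<noteq> v" "v' \<noteq> w" "u' \<noteq> w" "u \<noteq> w" "v \<noteq> w" "u \<notin> N w" "v \<notin> N w" "u' \<notin> N w" "v' \<notin> N w"
    "u' \<noteq> v" "v' \<noteq> u"
    using ou ov oppD[of v w u] oppD[of v' w u] oppD[of u' w v] by auto
  obtain r where r: "r \<in> isol (N u \<union> N v)" "r \<noteq> w" using linked_other_isol[OF l] .
  note rl = linked_isol[OF l r(1)]
  have r4: "card (N r) = 4" using regular_tight(1) isolD(6)[OF r(1)] by blast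
  \<comment> \<open>Stated for arbitrary \<open>S\<close>, \<open>T\<close>, \<open>v'\<close>,
    \<open>u'\<close> because it is applied again with the two sides of the path exchanged. If
    \<open>r\<close> is adjacent to \<open>v'\<close>, it misses \<open>T\<close> for lack of
    triangles; then \<open>N r\<close> must contain both \<open>u'\<close> and \<open>S\<close>,
    which gives a triangle again.\<close>
  have no: "v' \<notin> N r" if S: "S \<subseteq> N u'" "T \<subseteq> N v'" "card S = 2" "S \<noteq> {}"
      "N r \<subseteq> S \<union> T \<union> {v', u'}" for S T v' u'
  proof
    assume v': "v' \<in> N r"
    then have "T \<inter> N r = {}" using tf[OF v'] S(2) by blast
    then have sub: "N r \<subseteq> S \<union> {v', u'}" using S(5) by blast
    have "finite S" using S(3) by (simp add: card_ge_0_finite)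
    moreover have "card (S \<union> {v', u'}) \<le> 4"
      using card_Un_le[of S "{v', u'}"] S(3) card_length[of "[v', u']"] by simp
    ultimately have "N r = S \<union> {v', u'}" using card_seteq[OF _ sub] r4 by auto
    then show False using tf[of u' r] S(1,4) by blast
  qed
  have "v' \<notin> N r" using no[of S u' T v'] rl(1) Nw Su' Tv' cST STne by simp
  moreover have "u' \<notin> N r"
    using no[of T v' S u'] rl(1) Nw Su' Tv' cST STne by (simp add: Un_commute insert_commute)
  ultimately have "N r \<subseteq> N w" using rl(1) by auto
  then have Nr: "N r = N w" using card_seteq[of "N w" "N r"] w4 r4 by simp
  have rne: "r \<noteq> u" "r \<noteq> u'" "r \<noteq> v" "r \<noteq> v'" using rl(3) by auto
  have NS: "N n = {u, u'} \<union> {w, r}" if n: "n \<in> S" for n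
  proof (rule N_eqI)
    show "{u, u'} \<union> {w, r} \<subseteq> N n" using n Nw Nr Nu Su' N_sym[of n] by auto
    show "4 \<le> card ({u, u'} \<union> {w, r})" using uu' r rne ne by simp
  qed
  have NT: "N n = {w, r} \<union> {v, v'}" if n: "n \<in> T" for n
  proof (rule N_eqI)
    show "{w, r} \<union> {v, v'} \<subseteq> N n" using n Nw Nr Nv Tv' N_sym[of n] by auto
    show "4 \<le> card ({w, r} \<union> {v, v'})" using uu' r rne ne by simp
  qed
  have u'v': "u' \<noteq> v'"
  proof
    assume "u' = v'"
    then have "S \<union> T \<union> {v} \<subseteq> N u'" using Su' Tv' Nv N_sym[of u' v] by auto
    then have "card (S \<union> T \<union> {v}) \<le> 4" using card_mono[OF finite_N] N_card[of u'] le_trans by metis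
    then show False using ne(7) w4 STne unfolding Nw by simp
  qed
  \<comment> \<open>By \<open>h4\<close> there is an edge \<open>f\<close> beyond the three of the
    path. It avoids \<open>u\<close>, \<open>v\<close> and \<open>r\<close>, so the covers given by
    \<open>S\<close> and \<open>T\<close> force \<open>u'\<close> and \<open>v'\<close> into
    it.\<close>
  have "card {{u, v}, {u, v'}, {v, u'}} \<le> 3"
    using card_length[of "[{u, v}, {u, v'}, {v, u'}]"] by simp
  then have "\<not> hit w \<subseteq> {{u, v}, {u, v'}, {v, u'}}"
    using h4 card_mono[of "{{u, v}, {u, v'}, {v, u'}}" "hit w"] by fastforce
  then obtain f where f: "f \<in> hit w" "f \<notin> {{u, v}, {u, v'}, {v, u'}}" by blast
  have "f \<notin> star w u" "f \<notin> star w v"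
    unfolding star_eq ou ov using f(2) by (auto simp: insert_commute)
  then have fn: "u \<notin> f" "v \<notin> f" using f(1) by (simp_all add: star_def)
  have "r \<notin> f"
  proof
    assume "r \<in> f"
    with f(1) obtain h where "h \<in> opp w r" by (rule hit_memE)
    then show False using oppD(1,3)[of h w r] Nr by simp
  qed
  obtain n where n: "n \<in> S" using STne by blast
  then have "u' \<in> f" using hit_cover[OF f(1), of n] NS[OF n] Nw fn \<open>r \<notin> f\<close> by auto
  obtain m where m: "m \<in> T" using STne by blast
  then have "v' \<in> f" using hit_cover[OF f(1), of m] NT[OF m] Nw fn \<open>r \<notin> f\<close> by auto
  have "v' \<in> N u'"
  proof -
    obtain h where h: "f = {u', h}" "h \<in> opp w u'" using f(1) \<open>u' \<in> f\<close> by (rule hit_memE)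
    then show ?thesis using \<open>v' \<in> f\<close> u'v' oppD(1) by auto
  qed
  have Nu': "N u' = {v, v'} \<union> S"
  proof (rule N_eqI)
    show "{v, v'} \<union> S \<subseteq> N u'" using \<open>v' \<in> N u'\<close> Su' Nv N_sym[of u' v] by auto
    have "card ({v, v'} \<union> S) = card {v, v'} + card S"
      using Nw ne STne by (intro card_Un_disjoint) auto
    then show "4 \<le> card ({v, v'} \<union> S)" using cST uu' by simp
  qed
  have Nv': "N v' = T \<union> {u, u'}"
  proof (rule N_eqI)
    show "T \<union> {u, u'} \<subseteq> N v'" using N_sym[OF \<open>v' \<in> N u'\<close>] Tv' Nu N_sym[of v' u] by auto
    have "card (T \<union> {u, u'}) = card T + card {u, u'}"
      using Nw ne STne by (intro card_Un_disjoint) auto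
    then show "4 \<le> card (T \<union> {u, u'})" using cST uu' by simp
  qed
  show ?thesis
  proof (rule blowup5I[of "{w, r}" S "{u, u'}" "{v, v'}" T])
    show "N x = S \<union> T" if "x \<in> {w, r}" for x using that Nw Nr by auto
    show "N x = {v, v'} \<union> S" if "x \<in> {u, u'}" for x using that Nu Nu' by auto
    show "N x = T \<union> {u, u'}" if "x \<in> {v, v'}" for x using that Nv Nv' by auto
    show "N x = {u, u'} \<union> {w, r}" if "x \<in> S" for x using NS[OF that] .
    show "N x = {w, r} \<union> {v, v'}" if "x \<in> T" for x using NT[OF that] .
    show "card {w, r} = 2" "card {u, u'} = 2" "card {v, v'} = 2" using r uu' by auto
    show "{w, r} \<inter> {u, u'} = {}" "{w, r} \<inter> {v, v'} = {}" "{u, u'} \<inter> {v, v'} = {}"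
      using rne ne uu' u'v' by auto
    show "{w, r} \<inter> S = {}" "{w, r} \<inter> T = {}" "S \<inter> {u, u'} = {}" "S \<inter> {v, v'} = {}"
      "{u, u'} \<inter> T = {}" "{v, v'} \<inter> T = {}"
      using ne rl(2) N_irrefl[of w] Nw by auto
  qed (use cST disj in auto)
qed

text \<open>Without a path of three edges, the four edges of \<open>hit w\<close> split into two
  stars of two edges, at \<open>u\<close> and at \<open>x\<close>. The edge from \<open>u\<close> to
  \<open>v1\<close> must isolate a second vertex besides \<open>w\<close>, and no vertex
  qualifies.\<close>

lemma costly_blowup5:
  assumes w0: "N w \<noteq> {}"
  shows "blowup5 N"
proof (rule ccontr)
  assume nb: "\<not> blowup5 N"
  note tf = regular_tight(3) and w4 = regular_tight(1)[OF w0] and h4 = regular_tight(2)[OF w0]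
  have c4: "4 \<le> card (hit w)" using h4 by simp
  have nolink: False if "v \<in> opp w u" "2 \<le> card (star w u)" "2 \<le> card (star w v)" for u v
    using obtain_linked[OF w4 c4 that] linked_blowup5[OF w0] nb by metis
  have ex2: "\<exists>u\<in>N n - {w}. 2 \<le> card (star w u)" if n: "n \<in> N w" for n
  proof (rule ccontr)
    assume neg: "\<not> ?thesis"
    have "(\<Sum>x\<in>N n - {w}. card (star w x)) \<le> (\<Sum>x\<in>N n - {w}. 1)"
      using neg by (intro sum_mono) force
    then show False using hit_le_sum[OF n] c4 card_reach[OF n] by simp
  qed
  obtain n1 where "n1 \<in> N w" using w0 by blast
  then obtain u where u: "2 \<le> card (star w u)" using ex2 by blast
  note u2 = star_two[OF w4 c4 u]
  have "N w - N u \<noteq> {}"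
  proof
    assume "N w - N u = {}"
    then have "N u \<inter> N w = N w" by auto
    then show False using u2 w4 by simp
  qed
  then obtain n3 where n3: "n3 \<in> N w" "n3 \<notin> N u" by blast
  then obtain x where x: "n3 \<in> N x" "2 \<le> card (star w x)" using ex2[OF n3(1)] N_sym by blast
  note x2 = star_two[OF w4 c4 x(2)]
  have ux: "u \<noteq> x" using n3 x by auto
  \<comment> \<open>A common edge would be \<open>ux\<close>, the middle edge of a path with three
    edges.\<close>
  have "star w u \<inter> star w x = {}"
  proof (rule ccontr)
    assume "\<not> ?thesis"
    then obtain e where e: "e \<in> hit w" "u \<in> e" "x \<in> e" unfolding star_def by blast
    obtain v where "e = {u, v}" "v \<in> opp w u" using e(1,2) by (rule hit_memE)
    then show False using e(3) ux nolink[of x u] u x by auto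
  qed
  then have "card (star w u \<union> star w x) = 4"
    using u2(2) x2(2) by (simp add: card_Un_disjoint card_star)
  moreover have "star w u \<union> star w x \<subseteq> hit w" unfolding star_def by auto
  ultimately have hit: "hit w = star w u \<union> star w x"
    using card_seteq[of "hit w" "star w u \<union> star w x"] h4 by simp
  have F: "q = u \<or> q = x" if q: "2 \<le> card (star w q)" for q
  proof (rule ccontr)
    assume neg: "\<not> ?thesis"
    obtain e where e: "e \<in> star w q" using q by (cases "star w q = {}") auto
    then have "e \<in> hit w" "q \<in> e" unfolding star_def by auto
    then obtain p where p: "e = {q, p}" "p \<in> opp w q" by (rule hit_memE)
    have "u \<in> e \<or> x \<in> e" using \<open>e \<in> hit w\<close> hit unfolding star_def by auto
    then have "p = u \<or> p = x" using p neg by auto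
    then show False using nolink[OF p(2) q] u x by auto
  qed
  define S where "S = N u \<inter> N w"
  define T where "T = N x \<inter> N w"
  have cST: "card S = 2" "card T = 2" unfolding S_def T_def using u2 x2 by auto
  have Nw: "N w = S \<union> T" using ex2 F N_sym unfolding S_def T_def by blast
  have fin: "finite S" "finite T" unfolding S_def T_def by auto
  have disj: "S \<inter> T = {}"
  proof -
    have "card (S \<inter> T) = 0" using card_Un_Int[OF fin] cST w4 Nw by simp
    then show ?thesis using fin by simp
  qed
  have ne0: "S \<noteq> {}" "T \<noteq> {}" using cST by auto
  obtain v1 v2 where ou: "opp w u = {v1, v2}" "v1 \<noteq> v2" using u2(2) by (auto simp: card_2_iff)
  obtain y1 y2 where ox: "opp w x = {y1, y2}" "y1 \<noteq> y2" using x2(2) by (auto simp: card_2_iff)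
  have Nu: "N u = S \<union> {v1, v2}" using u2(3) ou unfolding S_def by simp
  have Nx: "N x = T \<union> {y1, y2}" using x2(3) ox unfolding T_def by simp
  have v: "v1 \<in> opp w u" "v2 \<in> opp w u" and y: "y1 \<in> opp w x" "y2 \<in> opp w x" using ou ox by auto
  have vx: "x \<notin> opp w u" "u \<notin> opp w x" using nolink u x by blast+
  have Tv: "T \<subseteq> N q" if "q \<in> opp w u" for q
    using opp_cover[OF that] disj unfolding S_def T_def by blast
  have Sy: "S \<subseteq> N q" if "q \<in> opp w x" for q
    using opp_cover[OF that] disj unfolding S_def T_def by blast
  have nw: "u \<noteq> w" "x \<noteq> w" "v1 \<noteq> w" "v2 \<noteq> w" "y1 \<noteq> w" "y2 \<noteq> w"
    "u \<notin> N w" "x \<notin> N w" "y1 \<notin> N w" "y2 \<notin> N w"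
    using oppD[OF v(1)] oppD[OF v(2)] oppD[OF y(1)] oppD[OF y(2)] by auto
  have yv: "q \<notin> opp w u" if q: "q \<in> opp w x" for q
  proof
    assume "q \<in> opp w u"
    then have "q \<in> N u" by (rule oppD)
    then show False using tf[of q u] Sy[OF q] ne0 unfolding S_def by blast
  qed
  have NS: "N n = {w, u, y1, y2}" if n: "n \<in> S" for n
  proof (rule N_eqI)
    show "{w, u, y1, y2} \<subseteq> N n" using n Nw Nu Sy[OF y(1)] Sy[OF y(2)] N_sym[of n] by auto
    show "4 \<le> card {w, u, y1, y2}" using nw ox vx by auto
  qed
  have NT: "N n = {w, x, v1, v2}" if n: "n \<in> T" for n
  proof (rule N_eqI)
    show "{w, x, v1, v2} \<subseteq> N n" using n Nw Nx Tv[OF v(1)] Tv[OF v(2)] N_sym[of n] by auto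
    show "4 \<le> card {w, x, v1, v2}" using nw ou vx by auto
  qed
  have v1u: "v1 \<in> N u" "u \<in> N v1" using oppD[OF v(1)] by auto
  have "card (N u \<union> N v1) \<le> 8" using card_Un_le[of "N u" "N v1"] N_card[of u] N_card[of v1] by linarith
  then have "2 \<le> card (isol (N u \<union> N v1))" using isol_large[OF v1u(1)] by fastforce
  then have "\<not> isol (N u \<union> N v1) \<subseteq> {w}"
    using card_mono[of "{w}" "isol (N u \<union> N v1)"] by auto
  then obtain r where r: "r \<in> isol (N u \<union> N v1)" "r \<noteq> w" by blast
  note r' = isolD[OF r(1)]
  have fT: "finite (insert u T)" using fin by simp
  have uT: "insert u T \<subseteq> N v1" "u \<notin> T" using Tv[OF v(1)] v1u nw Nw by auto
  \<comment> \<open>Outside \<open>S \<union> T\<close>, a neighbour of \<open>r\<close> can only be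
    \<open>v2\<close> or the at most one remaining neighbour of \<open>v1\<close>. As
    \<open>r\<close> has degree 4, it has a neighbour in \<open>S \<union> T\<close>.\<close>
  have "card (N v1 - insert u T) \<le> 1"
    using card_Diff_subset[OF fT uT(1)] uT(2) fin cST N_card[of v1] by simp
  then have "card (insert v2 (N v1 - insert u T)) \<le> 2"
    using card_insert_le_m1[of 2 "N v1 - insert u T" v2] by simp
  moreover have "4 = card (N r)" using regular_tight(1) r'(6) by simp
  ultimately have "\<not> N r \<subseteq> insert v2 (N v1 - insert u T)"
    using card_mono[of "insert v2 (N v1 - insert u T)" "N r"] by auto
  then obtain n where n: "n \<in> N r" "n \<notin> insert v2 (N v1 - insert u T)" by blast
  then have "n \<in> S \<union> T" using r' Nu by auto
  then have "r \<in> {w, u, y1, y2} \<or> r \<in> {w, x, v1, v2}" using NS NT N_sym[OF n(1)] by auto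
  moreover have "r \<noteq> u" "r \<noteq> v1" "r \<noteq> v2" using r' v1u Nu by auto
  ultimately consider "r \<in> opp w x" | "r = x" using r(2) ox by auto
  then show False
  proof cases
    case 1
    then have "x \<in> N u \<union> N v1" using r'(5) oppD(2) by blast
    moreover have "x \<notin> N u" using Nu nw Nw vx ou by auto
    moreover have "x \<notin> N v1" using tf[of x v1] Tv[OF v(1)] ne0 unfolding T_def by blast
    ultimately show False by blast
  next
    case 2
    have "{y1, y2} \<subseteq> N u \<union> N v1" using r'(5) 2 Nx by auto
    moreover have "y1 \<notin> N u" "y2 \<notin> N u" using Nu nw Nw yv[OF y(1)] yv[OF y(2)] ou by auto
    ultimately have sub: "T \<union> {u, y1, y2} \<subseteq> N v1" using uT by auto
    have uy: "u \<noteq> y1" "u \<noteq> y2" using vx y by auto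
    have "card (T \<union> {u, y1, y2}) = card T + card {u, y1, y2}"
      using fin nw Nw by (intro card_Un_disjoint) auto
    then have "card (T \<union> {u, y1, y2}) = 5" using cST uy ox by simp
    then show False using card_mono[OF finite_N sub] N_card[of v1] by simp
  qed
qed

end

theorem (in deg4_graph) exists_cheap_edge:
  assumes "N w \<noteq> {}" "\<not> blowup5 N"
  obtains u v where "v \<in> N u" "card (N u \<union> N v) + card (isol (N u \<union> N v)) \<le> 9"
proof (rule ccontr)
  assume neg: "\<not> thesis"
  have "costly_graph V N"
  proof
    fix u v assume "v \<in> N u"
    then have "\<not> card (N u \<union> N v) + card (isol (N u \<union> N v)) \<le> 9" using neg that by blast
    then show "10 \<le> card (N u \<union> N v) + card (isol (N u \<union> N v))" by linarith
  qed
  then show False using costly_graph.costly_blowup5[of V N w] assms by blast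
qed

section \<open>The induction\<close>

definition nbr :: "'a ugraph \<Rightarrow> 'a \<Rightarrow> 'a set" where
  "nbr G v = {u. adj G v u}"

lemma nbr_iff: "u \<in> nbr G v \<longleftrightarrow> {v, u} \<in> edges G"
  by (simp add: nbr_def adj_def)

lemma nbr_commute: "u \<in> nbr G v \<longleftrightarrow> v \<in> nbr G u"
  by (simp add: nbr_iff insert_commute)

lemma nbr_subset:
  assumes "finite_simple_graph G"
  shows "nbr G v \<subseteq> verts G"
proof
  fix u assume "u \<in> nbr G v"
  then have "{v, u} \<subseteq> verts G" using assms unfolding nbr_iff finite_simple_graph_def by blast
  then show "u \<in> verts G" by simp
qed

lemma nbr_nonempty:
  assumes "finite_simple_graph G" "nbr G v \<noteq> {}"
  shows "v \<in> verts G"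
proof -
  obtain u where "u \<in> nbr G v" using assms(2) by blast
  then have "v \<in> nbr G u" using nbr_commute[of u G v] by simp
  then show ?thesis using nbr_subset[OF assms(1), of u] by auto
qed

lemma nbr_irrefl:
  assumes "finite_simple_graph G"
  shows "v \<notin> nbr G v"
proof
  assume "v \<in> nbr G v"
  then have "card {v, v} = 2" using assms unfolding nbr_iff finite_simple_graph_def by blast
  then show False by simp
qed

lemma finite_edges:
  assumes "finite_simple_graph G"
  shows "finite (edges G)"
proof (rule finite_subset)
  show "edges G \<subseteq> Pow (verts G)" using assms unfolding finite_simple_graph_def by blast
  show "finite (Pow (verts G))" using assms unfolding finite_simple_graph_def by simp
qed

lemma degree_eq_card_nbr:
  assumes "finite_simple_graph G"
  shows "degree G v = card (nbr G v)"
proof -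
  have "{e \<in> edges G. v \<in> e} = (\<lambda>u. {v, u}) ` nbr G v"
  proof
    show "{e \<in> edges G. v \<in> e} \<subseteq> (\<lambda>u. {v, u}) ` nbr G v"
    proof
      fix e assume e: "e \<in> {e \<in> edges G. v \<in> e}"
      then have "card e = 2" using assms unfolding finite_simple_graph_def by blast
      then obtain a b where "e = {a, b}" by (auto simp: card_2_iff)
      then show "e \<in> (\<lambda>u. {v, u}) ` nbr G v"
        using e by (auto simp: nbr_iff insert_commute)
    qed
  qed (auto simp: nbr_iff)
  moreover have "inj_on (\<lambda>u. {v, u}) (nbr G v)" by (auto simp: inj_on_def doubleton_eq_iff)
  ultimately show ?thesis by (simp add: degree_def card_image)
qed

lemma deg4_graph_nbr:
  assumes "finite_simple_graph G" "\<And>v. card (nbr G v) \<le> 4"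
  shows "deg4_graph (verts G) (nbr G)"
proof
  show "finite (verts G)" using assms(1) by (simp add: finite_simple_graph_def)
  show "nbr G x \<subseteq> verts G" "x \<notin> nbr G x" "card (nbr G x) \<le> 4" for x
    using nbr_subset[OF assms(1)] nbr_irrefl[OF assms(1)] assms(2) by simp_all
  show "x \<in> nbr G y" if "y \<in> nbr G x" for x y
    using that nbr_commute[of y G x] by simp
qed

lemma nbr_remove:
  "nbr (induced_subgraph G (verts G - B)) v = (if v \<in> verts G - B then nbr G v \<inter> (verts G - B) else {})"
  by (auto simp: nbr_iff induced_subgraph_def)

text \<open>The blow-up is 4-regular, hence it is closed in every graph of maximum degree 4 containing it.\<close>

lemma blowup5_mono:
  fixes N N' :: "'a \<Rightarrow> 'a set"
  assumes "blowup5 N'" "\<And>x. N' x \<subseteq> N x" "\<And>x. finite (N x)" "\<And>x. card (N x) \<le> 4"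
  shows "blowup5 N"
proof -
  obtain X :: "nat \<Rightarrow> 'a set" where "\<forall>i<5. card (X i) = 2"
    "\<forall>i<5. \<forall>j<5. i \<noteq> j \<longrightarrow> X i \<inter> X j = {}"
    "\<forall>i<5. \<forall>x\<in>X i. N' x = X ((i + 1) mod 5) \<union> X ((i + 4) mod 5)"
    using assms(1) unfolding blowup5_def by (elim exE conjE)
  then have X: "\<And>i. i < 5 \<Longrightarrow> card (X i) = 2"
    "\<And>i j. i < 5 \<Longrightarrow> j < 5 \<Longrightarrow> i \<noteq> j \<Longrightarrow> X i \<inter> X j = {}"
    "\<And>i x. i < 5 \<Longrightarrow> x \<in> X i \<Longrightarrow> N' x = X ((i + 1) mod 5) \<union> X ((i + 4) mod 5)"
    by simp_all
  have "N x = N' x" if i: "i < 5" "x \<in> X i" for i x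
  proof -
    have "(i + 1) mod 5 \<noteq> (i + 4) mod 5" using i(1) by (auto simp: less_5_cases)
    then have "card (N' x) = 4"
      unfolding X(3)[OF i] using X(1,2) by (subst card_Un_disjoint) (auto intro: card_ge_0_finite)
    then show ?thesis using card_seteq[of "N x" "N' x"] assms(2-4)[of x] by simp
  qed
  then show ?thesis unfolding blowup5_def using X by (intro exI[of _ X]) simp
qed

text \<open>All edges at \<open>u\<close> or \<open>v\<close> end in \<open>B\<close>, whereas the
  edges of \<open>M\<close> avoid \<open>B\<close>; so nothing joins the new edge to
  \<open>M\<close>.\<close>

lemma induced_matching_insert:
  assumes G: "finite_simple_graph G" and v: "v \<in> nbr G u"
  defines "B \<equiv> nbr G u \<union> nbr G v"
  assumes M: "induced_matching (induced_subgraph G (verts G - B)) M"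
  shows "induced_matching G (insert {u, v} M)" "{u, v} \<notin> M"
proof -
  let ?H = "induced_subgraph G (verts G - B)"
  have uvB: "u \<in> B" "v \<in> B" using v nbr_commute unfolding B_def by fast+
  have ME: "e \<in> edges G" "e \<subseteq> verts G - B" if "e \<in> M" for e
    using M that unfolding induced_matching_def induced_subgraph_def by auto
  then show uvM: "{u, v} \<notin> M" using uvB by blast
  have far: "{x, c} \<notin> edges G" if "x = u \<or> x = v" "c \<notin> B" for x c
    using that nbr_iff[of c G u] nbr_iff[of c G v] unfolding B_def by auto
  show "induced_matching G (insert {u, v} M)"
    unfolding induced_matching_def
  proof (intro conjI ballI allI impI)
    show "insert {u, v} M \<subseteq> edges G" using ME(1) v by (auto simp: nbr_iff)
    fix x assume x: "x \<in> verts G"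
    show "card {e \<in> insert {u, v} M. x \<in> e} \<le> 1"
    proof (cases "x \<in> B")
      case True
      then have "{e \<in> insert {u, v} M. x \<in> e} \<subseteq> {{u, v}}" using ME(2) by auto
      then show ?thesis using card_mono[of "{{u, v}}"] by fastforce
    next
      case False
      then have "{e \<in> insert {u, v} M. x \<in> e} = {e \<in> M. x \<in> e}" using uvB by auto
      moreover have "x \<in> verts ?H" using x False by (simp add: induced_subgraph_def)
      ultimately show ?thesis using M unfolding induced_matching_def by simp
    qed
  next
    fix a b c d
    assume ab: "{a, b} \<in> insert {u, v} M" and cd: "{c, d} \<in> insert {u, v} M"
      and ne: "{a, b} \<noteq> {c, d}"
    have "{a, c} \<notin> edges G \<and> {a, d} \<notin> edges G \<and> {b, c} \<notin> edges G \<and> {b, d} \<notin> edges G"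
    proof -
      consider (1) "{a, b} = {u, v}" "{c, d} \<in> M" | (2) "{c, d} = {u, v}" "{a, b} \<in> M"
        | (3) "{a, b} \<in> M" "{c, d} \<in> M" using ab cd ne by auto
      then show ?thesis
      proof cases
        case 1
        then have "c \<notin> B" "d \<notin> B" "a = u \<or> a = v" "b = u \<or> b = v"
          using ME(2)[OF 1(2)] by (auto simp: doubleton_eq_iff)
        then show ?thesis using far by blast
      next
        case 2
        then have "a \<notin> B" "b \<notin> B" "c = u \<or> c = v" "d = u \<or> d = v"
          using ME(2)[OF 2(2)] by (auto simp: doubleton_eq_iff)
        then show ?thesis using far[of c a] far[of c b] far[of d a] far[of d b] by (auto simp: insert_commute)
      next
        case 3
        then have "{a, c} \<notin> edges ?H \<and> {a, d} \<notin> edges ?H \<and> {b, c} \<notin> edges ?H \<and> {b, d} \<notin> edges ?H"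
          using M ne unfolding induced_matching_def by blast
        then show ?thesis using ME(2)[OF 3(1)] ME(2)[OF 3(2)] by (simp add: induced_subgraph_def)
      qed
    qed
    then show "{a, c} \<notin> edges G" "{a, d} \<notin> edges G" "{b, c} \<notin> edges G" "{b, d} \<notin> edges G"
      by auto
  qed
qed

text \<open>A non-isolated vertex of \<open>G\<close> lies in \<open>B\<close>, becomes isolated
  when \<open>B\<close> is removed, or remains non-isolated in \<open>H\<close>. The first two kinds
  number at most 9 and are paid for by the new edge.\<close>

lemma exists_induced_matching:
  assumes "finite_simple_graph G" "\<And>v. card (nbr G v) \<le> 4" "\<not> blowup5 (nbr G)"
  shows "\<exists>M. induced_matching G M \<and> card {v. nbr G v \<noteq> {}} \<le> 9 * card M"
  using assms
proof (induction "card (verts G)" arbitrary: G rule: less_induct)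
  case less
  interpret deg4_graph "verts G" "nbr G" by (rule deg4_graph_nbr[OF less.prems(1,2)])
  show ?case
  proof (cases "\<exists>w. nbr G w \<noteq> {}")
    case False
    then show ?thesis by (intro exI[of _ "{}"]) (auto simp: induced_matching_def)
  next
    case True
    then obtain w where "nbr G w \<noteq> {}" by blast
    then obtain u v where uv: "v \<in> nbr G u"
      "card (nbr G u \<union> nbr G v) + card (isol (nbr G u \<union> nbr G v)) \<le> 9"
      using exists_cheap_edge[OF _ less.prems(3)] by blast
    define B where "B = nbr G u \<union> nbr G v"
    define H where "H = induced_subgraph G (verts G - B)"
    have NH: "nbr H x = (if x \<in> verts G - B then nbr G x \<inter> (verts G - B) else {})" for x
      unfolding H_def by (rule nbr_remove)
    then have sub: "nbr H x \<subseteq> nbr G x" for x by auto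
    have "u \<in> verts G \<inter> B" using uv N_subset N_sym unfolding B_def by blast
    then have "card (verts H) < card (verts G)"
      unfolding H_def induced_subgraph_def using finite_V by (auto intro!: psubset_card_mono)
    moreover have fH: "finite_simple_graph H"
      using less.prems(1) unfolding finite_simple_graph_def H_def induced_subgraph_def by auto
    moreover have "card (nbr H x) \<le> 4" for x
      using card_mono[OF finite_N sub] N_card le_trans by metis
    moreover have "\<not> blowup5 (nbr H)" using blowup5_mono[of "nbr H" "nbr G", OF _ sub finite_N N_card] less.prems(3) by blast
    ultimately obtain M where M: "induced_matching H M" "card {v. nbr H v \<noteq> {}} \<le> 9 * card M"
      using less.hyps[of H] by blast
    note ins = induced_matching_insert[OF less.prems(1) uv(1), folded B_def H_def, OF M(1)]
    have "M \<subseteq> edges H" using M(1) by (simp add: induced_matching_def)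
    then have "finite M" using finite_edges[OF fH] finite_subset by blast
    then have cM: "card (insert {u, v} M) = card M + 1" using ins(2) by simp
    have fB: "finite B" unfolding B_def by simp
    have fnH: "finite {v. nbr H v \<noteq> {}}"
      by (rule finite_subset[OF _ finite_V]) (auto simp: NH split: if_splits)
    have "{v. nbr G v \<noteq> {}} \<subseteq> B \<union> isol B \<union> {v. nbr H v \<noteq> {}}"
    proof
      fix x assume "x \<in> {v. nbr G v \<noteq> {}}"
      then have x: "nbr G x \<noteq> {}" by simp
      then have "x \<in> verts G" using N_subset N_sym by blast
      then show "x \<in> B \<union> isol B \<union> {v. nbr H v \<noteq> {}}"
        using x N_subset[of x] unfolding isol_def NH by auto
    qed
    then have "card {v. nbr G v \<noteq> {}} \<le> card (B \<union> isol B \<union> {v. nbr H v \<noteq> {}})"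
      using fB fnH by (intro card_mono) auto
    also have "\<dots> \<le> card (B \<union> isol B) + card {v. nbr H v \<noteq> {}}" by (rule card_Un_le)
    also have "\<dots> \<le> card B + card (isol B) + card {v. nbr H v \<noteq> {}}"
      using card_Un_le[of B "isol B"] by simp
    also have "\<dots> \<le> 9 + 9 * card M" using uv(2) M(2) unfolding B_def by linarith
    finally show ?thesis using ins(1) cM by (intro exI[of _ "insert {u, v} M"]) simp
  qed
qed

section \<open>Recognising \<open>C25\<close> as a component\<close>

lemma adj_C25:
  assumes "m < 5" "m' < 5" "j \<in> {1, 2}" "j' \<in> {1, 2}"
  shows "adj C25 (int m, j) (int m', j') \<longleftrightarrow> m' = (m + 1) mod 5 \<or> m' = (m + 4) mod 5"
proof -
  let ?R = "\<lambda>i i' :: int. [i' - i = 1] (mod 5) \<or> [i' - i = -1] (mod 5)"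
  \<comment> \<open>An unordered pair can match the definition of \<open>C25\<close> in either
    order, so the congruence condition has to be symmetric.\<close>
  have sym: "?R i i' \<longleftrightarrow> ?R i' i" for i i' :: int
    using cong_minus_minus_iff[of "i' - i" 1 5] cong_minus_minus_iff[of "i' - i" "-1" 5] by simp blast
  have "adj C25 (int m, j) (int m', j') \<longleftrightarrow> ?R (int m) (int m')"
  proof
    assume "adj C25 (int m, j) (int m', j')"
    then show "?R (int m) (int m')"
      unfolding adj_def C25_def using sym[of "int m" "int m'"] by (auto simp: doubleton_eq_iff)
  next
    assume "?R (int m) (int m')"
    then show "adj C25 (int m, j) (int m', j')"
      unfolding adj_def C25_def snd_conv mem_Collect_eq using assms
      by (intro exI[of _ "int m"] exI[of _ j] exI[of _ "int m'"] exI[of _ j']) auto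
  qed
  also have "\<dots> \<longleftrightarrow> m' = (m + 1) mod 5 \<or> m' = (m + 4) mod 5"
    using assms(1,2) unfolding less_5_cases by (elim disjE) (simp_all add: cong_def)
  finally show ?thesis .
qed

text \<open>The union \<open>U\<close> of the five pairs is closed under adjacency, and a walk round
  the cycle connects it, so it is the vertex set of a component.\<close>

lemma blowup5_component:
  assumes G: "finite_simple_graph G" and b: "blowup5 (nbr G)"
  shows "\<exists>H\<in>components G. isomorphic H C25"
proof -
  obtain X :: "nat \<Rightarrow> 'a set" where "\<forall>i<5. card (X i) = 2"
    "\<forall>i<5. \<forall>j<5. i \<noteq> j \<longrightarrow> X i \<inter> X j = {}"
    "\<forall>i<5. \<forall>x\<in>X i. nbr G x = X ((i + 1) mod 5) \<union> X ((i + 4) mod 5)"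
    using b unfolding blowup5_def by (elim exE conjE)
  then have X: "\<And>i. i < 5 \<Longrightarrow> card (X i) = 2"
    "\<And>i j. i < 5 \<Longrightarrow> j < 5 \<Longrightarrow> i \<noteq> j \<Longrightarrow> X i \<inter> X j = {}"
    "\<And>i x. i < 5 \<Longrightarrow> x \<in> X i \<Longrightarrow> nbr G x = X ((i + 1) mod 5) \<union> X ((i + 4) mod 5)"
    by simp_all
  have uniq: "i = j" if "x \<in> X i" "x \<in> X j" "i < 5" "j < 5" for x i j using X(2) that by blast
  have Xne: "X i \<noteq> {}" if "i < 5" for i using X(1)[OF that] by auto
  define U where "U = (\<Union>i<5. X i)"
  obtain x0 where x0: "x0 \<in> X 0" using Xne[of 0] by auto
  have XV: "X i \<subseteq> verts G" if "i < 5" for i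
  proof
    fix x assume "x \<in> X i"
    then have "nbr G x \<noteq> {}" using X(3)[OF that] Xne[of "(i + 1) mod 5"] by simp
    then show "x \<in> verts G" by (rule nbr_nonempty[OF G])
  qed
  \<comment> \<open>The partner of \<open>x0\<close> in \<open>X 0\<close> is not adjacent to
    \<open>x0\<close>; it is reached after a full turn, at \<open>k = 4\<close>.\<close>
  have reach: "(adj G)\<^sup>*\<^sup>* x0 y" if "y \<in> X ((k + 1) mod 5)" for k y
    using that
  proof (induction k arbitrary: y)
    case 0
    then have "y \<in> nbr G x0" using X(3)[OF _ x0] by simp
    then show ?case unfolding nbr_def by auto
  next
    case (Suc k)
    obtain z where z: "z \<in> X ((k + 1) mod 5)" using Xne[of "(k + 1) mod 5"] by auto
    have "((k + 1) mod 5 + 1) mod 5 = (Suc k + 1) mod 5" by presburger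
    then have "y \<in> nbr G z" using X(3)[OF _ z] Suc.prems by simp
    then show ?case using Suc.IH[OF z] unfolding nbr_def by (auto intro: rtranclp.rtrancl_into_rtrancl)
  qed
  have comp: "{v \<in> verts G. (adj G)\<^sup>*\<^sup>* x0 v} = U"
  proof
    show "{v \<in> verts G. (adj G)\<^sup>*\<^sup>* x0 v} \<subseteq> U"
    proof
      fix v assume "v \<in> {v \<in> verts G. (adj G)\<^sup>*\<^sup>* x0 v}"
      then have "(adj G)\<^sup>*\<^sup>* x0 v" by simp
      then show "v \<in> U"
      proof (induction rule: rtranclp_induct)
        case base
        then show ?case using x0 unfolding U_def by auto
      next
        case (step y z)
        then obtain i where i: "i < 5" "y \<in> X i" unfolding U_def by auto
        then have "z \<in> X ((i + 1) mod 5) \<union> X ((i + 4) mod 5)"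
          using step.hyps(2) X(3)[OF i] unfolding nbr_def by auto
        then show ?case unfolding U_def by (meson UN_I UnE lessThan_iff mod_less_divisor zero_less_numeral)
      qed
    qed
    show "U \<subseteq> {v \<in> verts G. (adj G)\<^sup>*\<^sup>* x0 v}"
    proof
      fix y assume "y \<in> U"
      then obtain i where i: "i < 5" "y \<in> X i" unfolding U_def by auto
      have "((i + 4) + 1) mod 5 = i" using i(1) by presburger
      then show "y \<in> {v \<in> verts G. (adj G)\<^sup>*\<^sup>* x0 v}" using reach[of y "i + 4"] i XV by auto
    qed
  qed
  let ?H = "induced_subgraph G U"
  have H: "?H \<in> components G"
    unfolding components_def using comp x0 XV[of 0] by force
  have "\<exists>a b. \<forall>i<5. X i = {a i, b i} \<and> a i \<noteq> b i"
    using X(1) unfolding card_2_iff by metis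
  then obtain a b where ab: "\<And>i. i < 5 \<Longrightarrow> X i = {a i, b i}" "\<And>i. i < 5 \<Longrightarrow> a i \<noteq> b i" by blast
  \<comment> \<open>The labels 1 and 2 select the two elements of a pair. The map leads from
    \<open>C25\<close> into \<open>G\<close>; its inverse witnesses
    \<open>isomorphic\<close>.\<close>
  define g where "g = (\<lambda>(i :: int, j :: nat). if j = 1 then a (nat i) else b (nat i))"
  let ?S = "{0..<5 :: int} \<times> {1, 2 :: nat}"
  have gX: "g (int m, j) \<in> X m" if "m < 5" for m j
    using ab(1)[OF that] by (auto simp: g_def)
  have Sint: "\<exists>m j. p = (int m, j) \<and> m < 5 \<and> j \<in> {1, 2}" if "p \<in> ?S" for p
    using that by (intro exI[of _ "nat (fst p)"] exI[of _ "snd p"]) auto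
  have inj: "inj_on g ?S"
  proof (rule inj_onI)
    fix p q assume pq: "p \<in> ?S" "q \<in> ?S" "g p = g q"
    obtain m j where p: "p = (int m, j)" "m < 5" "j \<in> {1, 2}" using Sint[OF pq(1)] by blast
    obtain m' j' where q: "q = (int m', j')" "m' < 5" "j' \<in> {1, 2}" using Sint[OF pq(2)] by blast
    have "m = m'" using uniq[of "g p" m m'] gX[OF p(2), of j] gX[OF q(2), of j'] p q pq(3) by simp
    moreover have "j = j'" using pq(3) p q calculation ab(2)[OF p(2)] by (auto simp: g_def)
    ultimately show "p = q" using p q by simp
  qed
  have img: "g ` ?S = U"
  proof
    show "g ` ?S \<subseteq> U"
    proof
      fix x assume "x \<in> g ` ?S"
      then obtain p where p: "x = g p" "p \<in> ?S" by (rule imageE)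
      obtain m j where "p = (int m, j)" "m < 5" using Sint[OF p(2)] by blast
      then show "x \<in> U" using gX[of m j] p(1) unfolding U_def by auto
    qed
    show "U \<subseteq> g ` ?S"
    proof
      fix x assume "x \<in> U"
      then obtain m where m: "m < 5" "x \<in> X m" unfolding U_def by auto
      then have "x = g (int m, 1) \<or> x = g (int m, 2)" using ab(1) by (auto simp: g_def)
      then show "x \<in> g ` ?S" using m(1) by auto
    qed
  qed
  have bij: "bij_betw g ?S U" using inj img by (simp add: bij_betw_def)
  have adj: "adj ?H (g p) (g q) \<longleftrightarrow> adj C25 p q" if pS: "p \<in> ?S" and qS: "q \<in> ?S" for p q
  proof -
    obtain m j where p: "p = (int m, j)" "m < 5" "j \<in> {1, 2}" using Sint[OF pS] by blast
    obtain m' j' where q: "q = (int m', j')" "m' < 5" "j' \<in> {1, 2}" using Sint[OF qS] by blast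
    have U: "g p \<in> U" "g q \<in> U" using img pS qS by auto
    have gp: "g p \<in> X m" "g q \<in> X m'" using gX p q by auto
    have "adj ?H (g p) (g q) \<longleftrightarrow> g q \<in> nbr G (g p)"
      using U by (simp add: adj_def induced_subgraph_def nbr_def)
    also have "\<dots> \<longleftrightarrow> g q \<in> X ((m + 1) mod 5) \<or> g q \<in> X ((m + 4) mod 5)"
      using X(3)[OF p(2) gp(1)] by simp
    also have "\<dots> \<longleftrightarrow> m' = (m + 1) mod 5 \<or> m' = (m + 4) mod 5"
    proof -
      have "g q \<in> X k \<longleftrightarrow> m' = k" if "k < 5" for k
        using uniq[OF gp(2) _ q(2) that] gp(2) by blast
      then show ?thesis by simp
    qed
    also have "\<dots> \<longleftrightarrow> adj C25 p q" using adj_C25[OF p(2) q(2) p(3) q(3)] p(1) q(1) by simp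
    finally show ?thesis .
  qed
  have "isomorphic ?H C25"
    unfolding isomorphic_def
  proof (intro exI[of _ "inv_into ?S g"] conjI ballI)
    show "bij_betw (inv_into ?S g) (verts ?H) (verts C25)"
      using bij_betw_inv_into[OF bij] by (simp add: induced_subgraph_def C25_def)
    fix x y assume "x \<in> verts ?H" "y \<in> verts ?H"
    then have xy: "x \<in> g ` ?S" "y \<in> g ` ?S" using img by (auto simp: induced_subgraph_def)
    show "adj ?H x y \<longleftrightarrow> adj C25 (inv_into ?S g x) (inv_into ?S g y)"
      using adj[OF inv_into_into[OF xy(1)] inv_into_into[OF xy(2)]] f_inv_into_f[OF xy(1)]
        f_inv_into_f[OF xy(2)] by simp
  qed
  then show ?thesis using H by blast
qed

theorem theorem1:
  fixes G :: "'a ugraph"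
  assumes "finite_simple_graph G"
    and "max_degree G \<le> 4"
    and "\<forall>H\<in>components G. \<not> isomorphic H C25"
  shows "real (strong_matching_number G) \<ge>
           (1 / 9) * (real (card (verts G)) - real (card (isolated_verts G)))"
proof -
  have fV: "finite (verts G)" using assms(1) by (simp add: finite_simple_graph_def)
  have deg: "card (nbr G v) \<le> 4" for v
  proof (cases "v \<in> verts G")
    case True
    then have "degree G v \<le> max_degree G" unfolding max_degree_def using fV by (intro Max_ge) auto
    then show ?thesis using degree_eq_card_nbr[OF assms(1)] assms(2) by simp
  next
    case False
    then have "nbr G v = {}" using nbr_nonempty[OF assms(1)] by blast
    then show ?thesis by simp
  qed
  have "\<not> blowup5 (nbr G)" using blowup5_component[OF assms(1)] assms(3) by blast
  then obtain M where M: "induced_matching G M" "card {v. nbr G v \<noteq> {}} \<le> 9 * card M"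
    using exists_induced_matching[OF assms(1) deg] by blast
  \<comment> \<open>\<open>Max\<close> bounds its elements only on finite sets.\<close>
  have "finite {card M | M. induced_matching G M}"
  proof (rule finite_subset)
    show "{card M | M. induced_matching G M} \<subseteq> card ` Pow (edges G)"
      unfolding induced_matching_def by auto
  qed (simp add: finite_edges[OF assms(1)])
  then have "card M \<le> strong_matching_number G"
    unfolding strong_matching_number_def using M(1) by (intro Max_ge) auto
  moreover have "card (verts G) = card (isolated_verts G) + card {v. nbr G v \<noteq> {}}"
  proof -
    have fn: "finite (nbr G v)" for v using nbr_subset[OF assms(1)] fV finite_subset by blast
    have "isolated_verts G = {v \<in> verts G. nbr G v = {}}"
      unfolding isolated_verts_def using degree_eq_card_nbr[OF assms(1)] fn by simp
    moreover have "{v. nbr G v \<noteq> {}} = verts G - {v \<in> verts G. nbr G v = {}}"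
      using nbr_nonempty[OF assms(1)] by blast
    ultimately show ?thesis using fV by (simp add: card_Diff_subset card_mono)
  qed
  ultimately have "real (card (verts G)) - real (card (isolated_verts G)) \<le> 9 * real (strong_matching_number G)"
    using M(2) by linarith
  then show ?thesis by simp
qed

end
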